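(* Let $n\ge2$, $m\ge1$ be integers, let $\Phi$ be a radial function on $\mathbb{R}^n$, let $1\le p,\tilde p<\infty$, and let $p_i,\tilde p_i$ $(1\le i\le m)$ be positive real numbers with $\frac1p=\sum_{i=1}^m\frac1{p_i}$ and $\frac1{\tilde p}=\sum_{i=1}^m\frac1{\tilde p_i}$. Then, for all $f_i\in L^{p_i}_{\rm rad}L^{\tilde p_i}_{\rm ang}(\mathbb{R}^n)$, $1\le i\le m$, $$\|H_\Phi(f_1,\dots,f_m)\|_{L^{p}_{\rm rad}L^{\tilde p}_{\rm ang}(\mathbb{R}^n)}\le \int_{\mathbb{R}^{nm}}\frac{|\Phi(|y|^{-1})|}{|y|^{nm}\prod_{i=1}^m|y_i|^{n/p_i}}\,dy\;\prod_{i=1}^m\|f_i\|_{L^{p_i}_{\rm rad}L^{\tilde p_i}_{\rm ang}(\mathbb{R}^n)} .$$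
   Context: $S^{n-1}$ is the unit sphere of $\mathbb{R}^n$ with (unnormalized) surface Lebesgue measure $d\sigma$. For $1\le p,\tilde p<\infty$, $$\|f\|_{L^{p}_{\rm rad}L^{\tilde p}_{\rm ang}(\mathbb{R}^n)}=\Big(\int_0^\infty\Big(\int_{S^{n-1}}|f(r\theta)|^{\tilde p}d\sigma(\theta)\Big)^{p/\tilde p}r^{n-1}dr\Big)^{1/p},$$ and the space consists of the measurable $f$ with finite norm. For functions $f_1,\dots,f_m$ on $\mathbb{R}^n$, $$H_\Phi(f_1,\dots,f_m)(x)=\int_{\mathbb{R}^{nm}}\frac{\Phi(x|y|^{-1})}{|y|^{nm}}\prod_{i=1}^m f_i(y_i)\,dy,\qquad x\in\mathbb{R}^n,$$ where $y=(y_1,\dots,y_m)$, $y_i\in\mathbb{R}^n$, and $|y|$ is the Euclidean norm in $\mathbb{R}^{nm}$. $\Phi$ is measurable; radial means $\Phi(x)$ depends only on $|x|$, and one writes $\Phi(t)$, $t>0$, for its value at points with $|x|=t$. The inequality has content when the integral constant on the right is finite. *)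

theory Defs
  imports "HOL-Analysis.Analysis"
begin

text \<open>Unnormalised surface measure on the unit sphere, given by the cone formula
  \<open>\<sigma>(A) = n \<cdot> \<lambda>({r \<theta> | 0 < r \<le> 1, \<theta> \<in> A})\<close>, i.e. the measure for which
  \<open>dx = r^(n-1) dr d\<sigma>(\<theta>)\<close> in polar coordinates; see \<open>emeasure_sphere_measure\<close> below.\<close>

definition sphere_measure :: "'a::euclidean_space measure" where
  "sphere_measure =
     scale_measure (of_nat DIM('a))
       (distr (restrict_space lborel (cball 0 1 - {0})) (restrict_space borel (sphere 0 1))
         (\<lambda>x. x /\<^sub>R norm x))"

lemma radial_projection_measurable:
  "(\<lambda>x::'a::euclidean_space. x /\<^sub>R norm x)
     \<in> restrict_space lborel (cball 0 1 - {0}) \<rightarrow>\<^sub>M restrict_space borel (sphere 0 1)"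
proof (rule measurable_restrict_space2)
  show "(\<lambda>x::'a. x /\<^sub>R norm x) \<in> space (restrict_space lborel (cball 0 1 - {0})) \<rightarrow> sphere 0 1"
    by (auto simp: space_restrict_space)
  have "(\<lambda>x::'a. x /\<^sub>R norm x) \<in> lborel \<rightarrow>\<^sub>M borel"
    by measurable
  then show "(\<lambda>x::'a. x /\<^sub>R norm x) \<in> restrict_space lborel (cball 0 1 - {0}) \<rightarrow>\<^sub>M borel"
    by (rule measurable_restrict_space1)
qed

lemma emeasure_sphere_measure:
  fixes A :: "'a::euclidean_space set"
  assumes A: "A \<in> sets borel" "A \<subseteq> sphere 0 1"
  shows "emeasure sphere_measure A =
           of_nat DIM('a) * emeasure lborel {r *\<^sub>R \<theta> | r \<theta>. 0 < r \<and> r \<le> 1 \<and> \<theta> \<in> A}"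
proof -
  have sets: "A \<in> sets (restrict_space borel (sphere 0 1))"
    using A by (auto simp: sets_restrict_space)
  have eq: "(\<lambda>x. x /\<^sub>R norm x) -` A \<inter> (cball 0 1 - {0})
              = {r *\<^sub>R \<theta> | r \<theta>. 0 < r \<and> r \<le> 1 \<and> \<theta> \<in> A}" (is "?L = ?R")
  proof (intro equalityI subsetI)
    fix x assume x: "x \<in> ?L"
    then have "x = norm x *\<^sub>R (x /\<^sub>R norm x)" "0 < norm x" "norm x \<le> 1" "x /\<^sub>R norm x \<in> A"
      by auto
    then show "x \<in> ?R" by blast
  next
    fix x assume "x \<in> ?R"
    then obtain r \<theta> where "x = r *\<^sub>R \<theta>" "0 < r" "r \<le> 1" "\<theta> \<in> A" by blast
    moreover from this have "norm \<theta> = 1" using A by auto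
    ultimately show "x \<in> ?L" by auto
  qed
  show ?thesis
    unfolding sphere_measure_def
    by (simp add: emeasure_distr[OF radial_projection_measurable sets]
        space_restrict_space emeasure_restrict_space eq[symmetric])
qed

text \<open>Real powers of extended nonnegative reals; only used with positive exponents.\<close>

definition ennreal_powr :: "ennreal \<Rightarrow> real \<Rightarrow> ennreal" where
  "ennreal_powr x a = (if x = \<infinity> then \<infinity> else ennreal (enn2real x powr a))"

definition rad_ang_norm :: "real \<Rightarrow> real \<Rightarrow> ('a::euclidean_space \<Rightarrow> complex) \<Rightarrow> ennreal" where
  "rad_ang_norm p q f =
     ennreal_powr
       (\<integral>\<^sup>+ r \<in> {0<..}.
          ennreal_powr (\<integral>\<^sup>+ \<theta>. ennreal (norm (f (r *\<^sub>R \<theta>)) powr q) \<partial>sphere_measure) (p / q)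
            * ennreal (r ^ (DIM('a) - 1)) \<partial>lborel)
       (1 / p)"

definition rad_ang_space :: "real \<Rightarrow> real \<Rightarrow> ('a::euclidean_space \<Rightarrow> complex) set" where
  "rad_ang_space p q = {f. f \<in> borel_measurable lebesgue \<and> rad_ang_norm p q f < \<infinity>}"

definition radial :: "('a::real_normed_vector \<Rightarrow> 'b) \<Rightarrow> bool" where
  "radial \<Phi> \<longleftrightarrow> (\<forall>x y. norm x = norm y \<longrightarrow> \<Phi> x = \<Phi> y)"

text \<open>\<open>radial_value \<Phi> t\<close> is the common value of a radial \<open>\<Phi>\<close> on the sphere of radius \<open>t \<ge> 0\<close>.\<close>

definition radial_value :: "('a::real_normed_vector \<Rightarrow> 'b) \<Rightarrow> real \<Rightarrow> 'b" where
  "radial_value \<Phi> t = (THE c. \<forall>x. norm x = t \<longrightarrow> \<Phi> x = c)"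

text \<open>In \<open>(real^'n)^'m\<close> the library norm is the Euclidean one on \<open>\<real>\<^sup>n\<^sup>m\<close> and
  \<open>lebesgue\<close> is Lebesgue measure on \<open>\<real>\<^sup>n\<^sup>m\<close>.  The completed measure is needed because the
  functions involved are only assumed Lebesgue measurable.\<close>

definition hausdorff_integrand ::
  "(real^'n \<Rightarrow> complex) \<Rightarrow> ('m \<Rightarrow> real^'n \<Rightarrow> complex) \<Rightarrow> real^'n \<Rightarrow> (real^'n)^'m \<Rightarrow> complex" where
  "hausdorff_integrand \<Phi> f x y =
     \<Phi> (x /\<^sub>R norm y) / complex_of_real (norm y ^ (CARD('n) * CARD('m))) * (\<Prod>i\<in>UNIV. f i (y $ i))"

definition hausdorff_op ::
  "(real^'n \<Rightarrow> complex) \<Rightarrow> ('m::finite \<Rightarrow> real^'n \<Rightarrow> complex) \<Rightarrow> real^'n \<Rightarrow> complex" where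
  "hausdorff_op \<Phi> f x = (\<integral>y. hausdorff_integrand \<Phi> f x y \<partial>lebesgue)"

definition hausdorff_const :: "(real^'n \<Rightarrow> complex) \<Rightarrow> ('m::finite \<Rightarrow> real) \<Rightarrow> ennreal" where
  "hausdorff_const \<Phi> p =
     (\<integral>\<^sup>+ y. ennreal (norm (radial_value \<Phi> (1 / norm y))
                / (norm y ^ (CARD('n) * CARD('m))
                   * (\<Prod>i\<in>UNIV. norm (y $ i) powr (real CARD('n) / p i))))
        \<partial>(lebesgue :: ((real^'n)^'m) measure))"

end

theory Submission
  imports Defs
begin

text \<open>Everything is compared with nonnegative Borel functions: \<open>f i\<close> agrees almost everywhere with a
  Borel function, and so does the profile of the radial function \<open>\<Phi>\<close>.  Rescaling \<open>y\<close> by \<open>norm x\<close> shows that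
  \<open>|H(x)|\<close> is at most \<open>F(norm x)\<close> with
  \<open>F r = \<integral> |\<Phi>(1/|y|)| |y|^(-nm) (\<Prod>i. |f i (r y_i)|) dy\<close>.  The weight only depends on the norms of the
  components, so in polar coordinates each \<open>|f i (r y_i)|\<close> may be replaced by its average over the sphere of
  radius \<open>r |y_i|\<close>, which Hoelder's inequality bounds by \<open>\<sigma>^(-1/q_i) G_i(r |y_i|)\<close>, where \<open>G_i\<close> is the
  angular \<open>L^(q_i)\<close> norm and \<open>\<sigma>\<close> the area of the unit sphere; the powers of \<open>\<sigma>\<close> cancel because
  \<open>1/q = \<Sum>i. 1/q_i\<close>.  Minkowski's integral inequality in
  \<open>L^p(r^(n-1) dr)\<close>, Hoelder's inequality with exponents \<open>p_i/p\<close> and the dilation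
  \<open>r \<mapsto> r |y_i|\<close>, which produces the factor \<open>|y_i|^(-n/p_i)\<close>, finish the estimate.\<close>

section \<open>Powers and integral inequalities for extended nonnegative reals\<close>

lemma ennreal_powr_ennreal [simp]: "0 \<le> x \<Longrightarrow> ennreal_powr (ennreal x) a = ennreal (x powr a)"
  by (simp add: ennreal_powr_def)

lemma ennreal_powr_top [simp]: "ennreal_powr top a = top"
  by (simp add: ennreal_powr_def)

lemma ennreal_powr_zero [simp]: "ennreal_powr 0 a = 0"
  by (simp add: ennreal_powr_def)

lemma ennreal_powr_one [simp]: "ennreal_powr 1 a = 1"
  by (simp add: ennreal_powr_def)

lemma ennreal_powr_eq_0_iff [simp]: "ennreal_powr x a = 0 \<longleftrightarrow> x = 0"
  by (cases x) (auto simp: ennreal_eq_0_iff top_unique)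

lemma ennreal_powr_eq_top_iff [simp]: "ennreal_powr x a = top \<longleftrightarrow> x = top"
  by (cases x) auto

lemma ennreal_powr_less_top_iff [simp]: "ennreal_powr x a < top \<longleftrightarrow> x < top"
  by (simp add: less_top[symmetric])

lemma ennreal_powr_exponent_one [simp]: "ennreal_powr x 1 = x"
  by (cases x) auto

lemma ennreal_powr_mono: "x \<le> y \<Longrightarrow> 0 \<le> a \<Longrightarrow> ennreal_powr x a \<le> ennreal_powr y a"
  by (cases x; cases y) (auto simp: top_unique intro!: ennreal_leI powr_mono2)

text \<open>Valid for every real exponent, including negative ones: 0 stays 0 and \<open>top\<close>
  stays \<open>top\<close> under \<open>ennreal_powr\<close>, so the convention
  \<open>0 * top = 0\<close> settles the mixed case in the same way on both sides.\<close>

lemma ennreal_powr_mult: "ennreal_powr (x * y) a = ennreal_powr x a * ennreal_powr y a"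
  by (cases x; cases y; cases "x = 0"; cases "y = 0")
     (auto simp: ennreal_mult[symmetric] powr_mult ennreal_mult_eq_top_iff ennreal_top_mult
        ennreal_mult_top powr_eq_0_iff ennreal_eq_0_iff)

lemma ennreal_powr_prod: "ennreal_powr (\<Prod>i\<in>I. x i) a = (\<Prod>i\<in>I. ennreal_powr (x i) a)"
  by (induction I rule: infinite_finite_induct) (auto simp: ennreal_powr_mult)

lemma ennreal_powr_powr: "ennreal_powr (ennreal_powr x a) b = ennreal_powr x (a * b)"
  by (cases x) (auto simp: powr_powr)

text \<open>At 0 and \<open>top\<close> this survives even when the exponents cancel, because
  \<open>ennreal_powr 0 0 = 0\<close> and \<open>ennreal_powr top 0 = top\<close>. The proof of
  Minkowski's inequality relies on it with the exponents \<open>p\<close> and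
  \<open>1 - p\<close>.\<close>

lemma ennreal_powr_add: "ennreal_powr x (a + b) = ennreal_powr x a * ennreal_powr x b"
  by (cases x) (auto simp: powr_add ennreal_mult)

text \<open>The index set is nonempty because the empty product is 1, while
  \<open>ennreal_powr x 0\<close> is 0 at 0 and \<open>top\<close> at \<open>top\<close>.\<close>

lemma ennreal_powr_sum:
  "finite I \<Longrightarrow> I \<noteq> {} \<Longrightarrow> ennreal_powr x (\<Sum>i\<in>I. a i) = (\<Prod>i\<in>I. ennreal_powr x (a i))"
  by (induction I rule: finite_ne_induct) (auto simp: ennreal_powr_add)

lemma measurable_ennreal_powr [measurable (raw)]:
  assumes [measurable]: "f \<in> borel_measurable M"
  shows "(\<lambda>x. ennreal_powr (f x) a) \<in> borel_measurable M"
  unfolding ennreal_powr_def by measurable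

section \<open>The inequalities of Hoelder and Minkowski\<close>

text \<open>Jensen's inequality for the convex function exp at the points \<open>ln (x i)\<close>. A
  vanishing \<open>x i\<close> is treated apart: it makes the left side 0.\<close>

lemma weighted_arith_geom_mean:
  fixes x a :: "'i \<Rightarrow> real"
  assumes I: "finite I" and a: "\<And>i. i \<in> I \<Longrightarrow> 0 < a i" "(\<Sum>i\<in>I. a i) = 1"
    and x: "\<And>i. i \<in> I \<Longrightarrow> 0 \<le> x i"
  shows "(\<Prod>i\<in>I. x i powr a i) \<le> (\<Sum>i\<in>I. a i * x i)"
proof (cases "\<exists>i\<in>I. x i = 0")
  case True
  then have "(\<Prod>i\<in>I. x i powr a i) = 0"
    using I by auto
  moreover have "0 \<le> (\<Sum>i\<in>I. a i * x i)"
    using a x by (intro sum_nonneg) (simp add: less_imp_le)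
  ultimately show ?thesis by simp
next
  case False
  then have pos: "0 < x i" if "i \<in> I" for i
    using x[OF that] that by (auto simp: less_le)
  have "I \<noteq> {}" using a by auto
  have "(\<Prod>i\<in>I. x i powr a i) = exp (\<Sum>i\<in>I. a i * ln (x i))"
    unfolding exp_sum[OF I] by (intro prod.cong refl) (use pos in \<open>force simp: powr_def\<close>)
  also have "\<dots> \<le> (\<Sum>i\<in>I. a i * exp (ln (x i)))"
    using convex_on_sum[OF I \<open>I \<noteq> {}\<close> exp_convex a(2), of "\<lambda>i. ln (x i)"] a(1)
    by (simp add: less_imp_le)
  also have "\<dots> = (\<Sum>i\<in>I. a i * x i)"
    using pos by (intro sum.cong) auto
  finally show ?thesis .
qed

lemma weighted_arith_geom_mean_ennreal:
  fixes x :: "'i \<Rightarrow> ennreal" and a :: "'i \<Rightarrow> real"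
  assumes I: "finite I" and a: "\<And>i. i \<in> I \<Longrightarrow> 0 < a i" "(\<Sum>i\<in>I. a i) = 1"
  shows "(\<Prod>i\<in>I. ennreal_powr (x i) (a i)) \<le> (\<Sum>i\<in>I. ennreal (a i) * x i)"
proof (cases "\<exists>i\<in>I. x i = top")
  case True
  then obtain j where j: "j \<in> I" "x j = top" by auto
  have "ennreal (a j) * x j \<le> (\<Sum>i\<in>I. ennreal (a i) * x i)"
    using j I by (intro member_le_sum) auto
  moreover have "ennreal (a j) * x j = top"
    using j a(1)[of j] by (simp add: ennreal_mult_top ennreal_eq_0_iff)
  ultimately show ?thesis by (simp add: top_unique)
next
  case False
  define y where "y i = enn2real (x i)" for i
  have x: "x i = ennreal (y i)" if "i \<in> I" for i
    using False that by (auto simp: y_def less_top)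
  have y: "0 \<le> y i" for i by (simp add: y_def)
  have "(\<Prod>i\<in>I. ennreal_powr (x i) (a i)) = ennreal (\<Prod>i\<in>I. y i powr a i)"
    by (simp add: x y prod_ennreal[symmetric])
  also have "\<dots> \<le> ennreal (\<Sum>i\<in>I. a i * y i)"
    using I a y by (intro ennreal_leI weighted_arith_geom_mean) auto
  also have "\<dots> = (\<Sum>i\<in>I. ennreal (a i) * x i)"
    using a y by (subst sum_ennreal[symmetric]) (auto simp: x less_imp_le ennreal_mult intro!: sum.cong)
  finally show ?thesis .
qed

text \<open>After each \<open>u i\<close> is divided by its integral \<open>U i\<close>, the
  pointwise arithmetic-geometric mean inequality integrates to the sum of the weights, which is 1.
  This needs \<open>U i\<close> finite and nonzero. If some \<open>U i\<close> is 0, the product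
  vanishes almost everywhere; if none is 0 but one is infinite, the right side is
  \<open>top\<close>.\<close>

lemma nn_integral_Holder:
  fixes u :: "'i \<Rightarrow> 'x \<Rightarrow> ennreal" and a :: "'i \<Rightarrow> real"
  assumes I: "finite I" and a: "\<And>i. i \<in> I \<Longrightarrow> 0 < a i" "(\<Sum>i\<in>I. a i) = 1"
    and u [measurable]: "\<And>i. i \<in> I \<Longrightarrow> u i \<in> borel_measurable M"
  shows "(\<integral>\<^sup>+x. (\<Prod>i\<in>I. ennreal_powr (u i x) (a i)) \<partial>M)
           \<le> (\<Prod>i\<in>I. ennreal_powr (\<integral>\<^sup>+x. u i x \<partial>M) (a i))"
proof (cases "\<exists>i\<in>I. (\<integral>\<^sup>+x. u i x \<partial>M) = 0")
  case True
  then obtain j where j: "j \<in> I" "(\<integral>\<^sup>+x. u j x \<partial>M) = 0" by auto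
  then have "AE x in M. u j x = 0"
    using nn_integral_0_iff_AE[of "u j" M] u by auto
  then have "AE x in M. (\<Prod>i\<in>I. ennreal_powr (u i x) (a i)) = 0"
    by eventually_elim (use I j in auto)
  then have "(\<integral>\<^sup>+x. (\<Prod>i\<in>I. ennreal_powr (u i x) (a i)) \<partial>M) = (\<integral>\<^sup>+x. 0 \<partial>M)"
    by (intro nn_integral_cong_AE) auto
  then show ?thesis by simp
next
  case nz: False
  define U where "U i = (\<integral>\<^sup>+x. u i x \<partial>M)" for i
  show ?thesis
  proof (cases "\<exists>i\<in>I. U i = top")
    case True
    then have "(\<Prod>i\<in>I. ennreal_powr (U i) (a i)) = top"
      using nz I by (auto simp: ennreal_prod_eq_top U_def)
    then show ?thesis by (simp add: U_def)
  next
    case False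
    then have fin: "U i < top" and pos: "U i \<noteq> 0" if "i \<in> I" for i
      using nz that by (auto simp: U_def less_top)
    have split: "u i x = U i * (u i x / U i)" if "i \<in> I" for i x
      using fin[OF that] pos[OF that]
      by (metis ennreal_mult_divide_eq ennreal_times_divide mult.commute order_less_irrefl)
    have "(\<integral>\<^sup>+x. (\<Prod>i\<in>I. ennreal_powr (u i x) (a i)) \<partial>M)
        = (\<integral>\<^sup>+x. (\<Prod>i\<in>I. ennreal_powr (U i) (a i)) * (\<Prod>i\<in>I. ennreal_powr (u i x / U i) (a i)) \<partial>M)"
      by (subst prod.distrib[symmetric], intro nn_integral_cong prod.cong refl)
         (metis split ennreal_powr_mult)
    also have "\<dots> \<le> (\<integral>\<^sup>+x. (\<Prod>i\<in>I. ennreal_powr (U i) (a i)) * (\<Sum>i\<in>I. ennreal (a i) * (u i x / U i)) \<partial>M)"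
      using I a by (intro nn_integral_mono mult_left_mono weighted_arith_geom_mean_ennreal) auto
    also have "\<dots> = (\<Prod>i\<in>I. ennreal_powr (U i) (a i)) * (\<Sum>i\<in>I. ennreal (a i) * (U i / U i))"
      by (simp add: nn_integral_cmult nn_integral_sum nn_integral_divide U_def)
    also have "(\<Sum>i\<in>I. ennreal (a i) * (U i / U i)) = (\<Sum>i\<in>I. ennreal (a i))"
      using fin pos by (intro sum.cong) (auto simp: less_top)
    also have "\<dots> = 1"
      using a by (simp add: sum_ennreal less_imp_le)
    finally show ?thesis by (simp add: U_def)
  qed
qed

lemma nn_integral_Holder2:
  assumes "0 < a" "a < 1" and [measurable]: "u \<in> borel_measurable M" "v \<in> borel_measurable M"
  shows "(\<integral>\<^sup>+x. ennreal_powr (u x) a * ennreal_powr (v x) (1 - a) \<partial>M)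
           \<le> ennreal_powr (\<integral>\<^sup>+x. u x \<partial>M) a * ennreal_powr (\<integral>\<^sup>+x. v x \<partial>M) (1 - a)"
  using nn_integral_Holder[of UNIV "\<lambda>b. if b then a else 1 - a" "\<lambda>b. if b then u else v" M] assms
  by (simp add: UNIV_bool mult.commute)

text \<open>The splitting \<open>K = (K^p B^(1-p))^(1/p) B^(1-1/p)\<close> and Hoelder's inequality in \<open>y\<close> avoid the duality argument
  and the truncation it would require.\<close>

lemma nn_integral_Minkowski:
  assumes "sigma_finite_measure M" "sigma_finite_measure N" and p: "1 \<le> p"
    and K [measurable]: "case_prod K \<in> borel_measurable (M \<Otimes>\<^sub>M N)"
    and B [measurable]: "B \<in> borel_measurable N"
    and bound: "AE y in N. (\<integral>\<^sup>+r. ennreal_powr (K r y) p \<partial>M) \<le> ennreal_powr (B y) p"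
  shows "(\<integral>\<^sup>+r. ennreal_powr (\<integral>\<^sup>+y. K r y \<partial>N) p \<partial>M) \<le> ennreal_powr (\<integral>\<^sup>+y. B y \<partial>N) p"
proof -
  interpret M: sigma_finite_measure M by fact
  interpret N: sigma_finite_measure N by fact
  interpret P: pair_sigma_finite M N ..
  \<comment> \<open>The main case needs \<open>B\<close> finite almost everywhere and, for the
    two-factor Hoelder inequality, the exponent \<open>1 / p\<close> strictly below 1. For
    \<open>p = 1\<close> Tonelli's theorem suffices.\<close>
  consider "(\<integral>\<^sup>+y. B y \<partial>N) = top" | "p = 1" | "(\<integral>\<^sup>+y. B y \<partial>N) \<noteq> top" "1 < p"
    using p by linarith
  then show ?thesis
  proof cases
    case 1
    then show ?thesis by simp
  next
    case 2
    have "(\<integral>\<^sup>+r. (\<integral>\<^sup>+y. K r y \<partial>N) \<partial>M) = (\<integral>\<^sup>+y. (\<integral>\<^sup>+r. K r y \<partial>M) \<partial>N)"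
      by (rule P.Fubini'[symmetric]) measurable
    also have "\<dots> \<le> (\<integral>\<^sup>+y. B y \<partial>N)"
      using bound 2 by (intro nn_integral_mono_AE) simp
    finally show ?thesis using 2 by simp
  next
    case 3
    let ?B = "\<integral>\<^sup>+y. B y \<partial>N"
    have fin: "AE y in N. B y \<noteq> top"
      using nn_integral_PInf_AE[OF B] 3 by simp
    \<comment> \<open>Where \<open>B y\<close> is 0 the splitting of \<open>K\<close> breaks down,
      since \<open>ennreal_powr 0 (1 - p) = 0\<close>. There \<open>bound\<close> forces
      \<open>K r y = 0\<close> for almost every \<open>r\<close>. The quantifiers are then
      exchanged, because the splitting is used for fixed \<open>r\<close>.\<close>
    have "AE y in N. AE r in M. B y = 0 \<longrightarrow> K r y = 0"
      using bound AE_space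
    proof eventually_elim
      case (elim y)
      have [measurable]: "(\<lambda>r. K r y) \<in> borel_measurable M"
        using elim by measurable
      show ?case
      proof (cases "B y = 0")
        case True
        then have "(\<integral>\<^sup>+r. ennreal_powr (K r y) p \<partial>M) = 0"
          using elim by simp
        then have "AE r in M. ennreal_powr (K r y) p = 0"
          by (subst (asm) nn_integral_0_iff_AE) auto
        then show ?thesis by eventually_elim auto
      qed simp
    qed
    then have null: "AE r in M. AE y in N. B y = 0 \<longrightarrow> K r y = 0"
      by (subst P.AE_commute) measurable
    have "AE r in M. ennreal_powr (\<integral>\<^sup>+y. K r y \<partial>N) p
            \<le> (\<integral>\<^sup>+y. ennreal_powr (K r y) p * ennreal_powr (B y) (1 - p) \<partial>N) * ennreal_powr ?B (p - 1)"
      using null AE_space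
    proof eventually_elim
      case (elim r)
      have [measurable]: "(\<lambda>y. K r y) \<in> borel_measurable N"
        using elim by measurable
      let ?u = "\<lambda>y. ennreal_powr (K r y) p * ennreal_powr (B y) (1 - p)"
      have "(\<integral>\<^sup>+y. K r y \<partial>N) = (\<integral>\<^sup>+y. ennreal_powr (?u y) (1 / p) * ennreal_powr (B y) (1 - 1 / p) \<partial>N)"
      proof (intro nn_integral_cong_AE)
        show "AE y in N. K r y = ennreal_powr (?u y) (1 / p) * ennreal_powr (B y) (1 - 1 / p)"
          using elim(1) fin
        proof eventually_elim
          case (elim y)
          show ?case
          proof (cases "B y = 0")
            case False
            then obtain b where b: "B y = ennreal b" "0 < b"
              using elim by (cases "B y") (auto simp: ennreal_eq_0_iff)
            have "(1 - p) * (1 / p) + (1 - 1 / p) = 0"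
              using 3 by (simp add: field_simps)
            then have "ennreal_powr (B y) ((1 - p) * (1 / p)) * ennreal_powr (B y) (1 - 1 / p) = 1"
              unfolding ennreal_powr_add[symmetric] using b by simp
            then show ?thesis
              using 3 by (simp add: ennreal_powr_mult ennreal_powr_powr mult.assoc)
          qed (use elim in simp)
        qed
      qed
      also have "\<dots> \<le> ennreal_powr (\<integral>\<^sup>+y. ?u y \<partial>N) (1 / p) * ennreal_powr ?B (1 - 1 / p)"
        using 3 by (intro nn_integral_Holder2) auto
      finally have "ennreal_powr (\<integral>\<^sup>+y. K r y \<partial>N) p
          \<le> ennreal_powr (ennreal_powr (\<integral>\<^sup>+y. ?u y \<partial>N) (1 / p) * ennreal_powr ?B (1 - 1 / p)) p"
        using 3 by (intro ennreal_powr_mono) auto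
      also have "\<dots> = (\<integral>\<^sup>+y. ?u y \<partial>N) * ennreal_powr ?B (p - 1)"
        using 3 by (simp add: ennreal_powr_mult ennreal_powr_powr left_diff_distrib)
      finally show ?case .
    qed
    then have "(\<integral>\<^sup>+r. ennreal_powr (\<integral>\<^sup>+y. K r y \<partial>N) p \<partial>M)
        \<le> (\<integral>\<^sup>+r. (\<integral>\<^sup>+y. ennreal_powr (K r y) p * ennreal_powr (B y) (1 - p) \<partial>N) * ennreal_powr ?B (p - 1) \<partial>M)"
      by (intro nn_integral_mono_AE)
    also have "\<dots> = (\<integral>\<^sup>+r. (\<integral>\<^sup>+y. ennreal_powr (K r y) p * ennreal_powr (B y) (1 - p) \<partial>N) \<partial>M) * ennreal_powr ?B (p - 1)"
      by (rule nn_integral_multc) measurable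
    also have "(\<integral>\<^sup>+r. (\<integral>\<^sup>+y. ennreal_powr (K r y) p * ennreal_powr (B y) (1 - p) \<partial>N) \<partial>M)
        = (\<integral>\<^sup>+y. (\<integral>\<^sup>+r. ennreal_powr (K r y) p * ennreal_powr (B y) (1 - p) \<partial>M) \<partial>N)"
      by (rule P.Fubini'[symmetric]) measurable
    also have "\<dots> = (\<integral>\<^sup>+y. (\<integral>\<^sup>+r. ennreal_powr (K r y) p \<partial>M) * ennreal_powr (B y) (1 - p) \<partial>N)"
      by (intro nn_integral_cong nn_integral_multc) measurable
    \<comment> \<open>By \<open>bound\<close> the inner integral is at most
      \<open>ennreal_powr (B y) p\<close>, and the exponents \<open>p\<close> and
      \<open>1 - p\<close> add up to 1.\<close>
    also have "\<dots> \<le> (\<integral>\<^sup>+y. B y \<partial>N)"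
    proof (intro nn_integral_mono_AE)
      show "AE y in N. (\<integral>\<^sup>+r. ennreal_powr (K r y) p \<partial>M) * ennreal_powr (B y) (1 - p) \<le> B y"
        using bound fin
      proof eventually_elim
        case (elim y)
        have "(\<integral>\<^sup>+r. ennreal_powr (K r y) p \<partial>M) * ennreal_powr (B y) (1 - p)
            \<le> ennreal_powr (B y) p * ennreal_powr (B y) (1 - p)"
          using elim by (intro mult_right_mono) auto
        then show ?case by (simp add: ennreal_powr_add[symmetric])
      qed
    qed
    also have "?B * ennreal_powr ?B (p - 1) = ennreal_powr ?B (1 + (p - 1))"
      unfolding ennreal_powr_add by simp
    finally show ?thesis
      by (simp add: mult_right_mono)
  qed
qed

section \<open>Polar coordinates\<close>

lemma space_sphere_measure [simp]: "space (sphere_measure :: 'a::euclidean_space measure) = sphere 0 1"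
  by (simp add: sphere_measure_def space_restrict_space space_scale_measure)

lemma sets_sphere_measure:
  "sets (sphere_measure :: 'a::euclidean_space measure) = sets (restrict_space borel (sphere 0 1))"
  by (simp add: sphere_measure_def)

lemma measurable_ident_sphere_measure:
  "(\<lambda>x. x) \<in> (sphere_measure :: 'a::euclidean_space measure) \<rightarrow>\<^sub>M borel"
  by (subst measurable_cong_sets[OF sets_sphere_measure refl]) (simp add: measurable_restrict_space1)

lemma measurable_polar:
  fixes h :: "'a::euclidean_space \<Rightarrow> 'b" and \<theta> :: "'c \<Rightarrow> 'a"
  assumes h: "h \<in> borel \<rightarrow>\<^sub>M N" and [measurable]: "\<rho> \<in> borel_measurable M" "\<theta> \<in> M \<rightarrow>\<^sub>M sphere_measure"
  shows "(\<lambda>x. h (\<rho> x *\<^sub>R \<theta> x)) \<in> M \<rightarrow>\<^sub>M N"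
proof -
  have "\<theta> \<in> M \<rightarrow>\<^sub>M borel"
    by (rule measurable_compose[OF assms(3) measurable_ident_sphere_measure])
  then have "(\<lambda>x. \<rho> x *\<^sub>R \<theta> x) \<in> M \<rightarrow>\<^sub>M borel"
    by measurable
  then show ?thesis by (rule measurable_compose[OF _ h])
qed

lemma nn_integral_sphere_measure:
  fixes k :: "'a::euclidean_space \<Rightarrow> ennreal"
  assumes [measurable]: "k \<in> borel_measurable borel"
  shows "(\<integral>\<^sup>+\<theta>. k \<theta> \<partial>sphere_measure)
    = of_nat DIM('a) * (\<integral>\<^sup>+x. k (x /\<^sub>R norm x) * indicator (cball 0 1 - {0}) x \<partial>lborel)"
proof -
  have k: "k \<in> borel_measurable (restrict_space borel (sphere 0 1))"
    by (simp add: measurable_restrict_space1)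
  have "(\<integral>\<^sup>+\<theta>. k \<theta> \<partial>sphere_measure) =
     of_nat DIM('a) * (\<integral>\<^sup>+\<theta>. k \<theta> \<partial>distr (restrict_space lborel (cball 0 1 - {0}))
         (restrict_space borel (sphere 0 1)) (\<lambda>x. x /\<^sub>R norm x))"
    unfolding sphere_measure_def by (rule nn_integral_scale_measure) (simp add: k)
  also have "\<dots> = of_nat DIM('a) * (\<integral>\<^sup>+x. k (x /\<^sub>R norm x) \<partial>restrict_space lborel (cball 0 1 - {0}))"
    by (subst nn_integral_distr[OF radial_projection_measurable]) (auto simp: k)
  also have "\<dots> = of_nat DIM('a) * (\<integral>\<^sup>+x. k (x /\<^sub>R norm x) * indicator (cball 0 1 - {0}) x \<partial>lborel)"
    by (subst nn_integral_restrict_space) auto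
  finally show ?thesis .
qed

lemma emeasure_sphere_measure_sphere:
  "emeasure (sphere_measure :: 'a::euclidean_space measure) (sphere 0 1)
     = of_nat DIM('a) * emeasure lborel (cball (0::'a) 1 - {0})"
proof -
  have "emeasure (sphere_measure :: 'a measure) (sphere 0 1) = (\<integral>\<^sup>+\<theta>. 1 \<partial>(sphere_measure :: 'a measure))"
    by simp
  also have "\<dots> = of_nat DIM('a) * emeasure lborel (cball (0::'a) 1 - {0})"
    by (subst nn_integral_sphere_measure) (auto simp: nn_integral_indicator)
  finally show ?thesis .
qed

lemma emeasure_cball_minus_center:
  "emeasure lborel (cball (0::'a::euclidean_space) 1 - {0}) = ennreal (unit_ball_vol (DIM('a)))"
proof -
  have "emeasure lborel (cball (0::'a) 1 - {0}) = emeasure lborel (cball (0::'a) 1)"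
    by (rule emeasure_Diff_null_set) auto
  then show ?thesis by (simp add: emeasure_cball)
qed

lemma finite_measure_sphere_measure: "finite_measure (sphere_measure :: 'a::euclidean_space measure)"
  by (rule finite_measureI)
     (simp add: emeasure_sphere_measure_sphere emeasure_cball_minus_center ennreal_mult_eq_top_iff)

lemma emeasure_sphere_measure_sphere_neq_0:
  "emeasure (sphere_measure :: 'a::euclidean_space measure) (sphere 0 1) \<noteq> 0"
  by (simp add: emeasure_sphere_measure_sphere emeasure_cball_minus_center
      ennreal_eq_0_iff not_le)

lemma sigma_finite_sphere_measure: "sigma_finite_measure (sphere_measure :: 'a::euclidean_space measure)"
  by (rule finite_measure.axioms(1)[OF finite_measure_sphere_measure])

lemma pair_sigma_finite_lborel_sphere_measure:
  "pair_sigma_finite (lborel :: 'b::euclidean_space measure) (sphere_measure :: 'a::euclidean_space measure)"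
  by (intro pair_sigma_finite.intro sigma_finite_sphere_measure sigma_finite_lborel)

lemma borel_measurable_sphere_integral [measurable]:
  fixes h :: "'a::euclidean_space \<Rightarrow> ennreal"
  assumes "h \<in> borel_measurable borel"
  shows "(\<lambda>r. \<integral>\<^sup>+\<theta>. h (r *\<^sub>R \<theta>) \<partial>sphere_measure) \<in> borel_measurable borel"
  by (rule sigma_finite_measure.borel_measurable_nn_integral[OF sigma_finite_sphere_measure])
     (auto simp: split_beta' intro!: measurable_polar assms)

section \<open>Dilations and the polar coordinate formula\<close>

lemma nn_integral_lborel_scaleR:
  fixes h :: "'a::euclidean_space \<Rightarrow> ennreal"
  assumes [measurable]: "h \<in> borel_measurable borel" and c: "0 < c"
  shows "(\<integral>\<^sup>+x. h x \<partial>lborel) = ennreal (c ^ DIM('a)) * (\<integral>\<^sup>+x. h (c *\<^sub>R x) \<partial>lborel)"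
  using c by (subst lborel_affine[of c 0])
     (simp_all add: nn_integral_density nn_integral_distr nn_integral_cmult)

lemma AE_lborel_neq: "AE x in (lborel :: 'a::euclidean_space measure). x \<noteq> c"
  by (rule AE_not_in[of "{c}", simplified]) auto

text \<open>The inner integral of the polar coordinate formula. The antiderivative
  \<open>- (1 / s ^ n)\<close> tends to 0 at infinity.\<close>

lemma nn_integral_inverse_power_tail:
  fixes a :: real
  assumes "0 < a" "0 < n"
  shows "(\<integral>\<^sup>+s. ennreal (real n / s ^ Suc n) * indicator {a..} s \<partial>lborel) = ennreal (1 / a ^ n)"
proof -
  have "((\<lambda>s::real. inverse (s ^ n)) \<longlongrightarrow> 0) at_top"
    by (intro tendsto_inverse_0_at_top filterlim_pow_at_top filterlim_ident) (use assms in auto)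
  then have "((\<lambda>s::real. - (1 / s ^ n)) \<longlongrightarrow> 0) at_top"
    using tendsto_minus by (fastforce simp: inverse_eq_divide)
  moreover have "((\<lambda>s. - (1 / s ^ n)) has_real_derivative (real n / x ^ Suc n)) (at x)" if "a \<le> x" for x
  proof -
    obtain k where k: "n = Suc k" using assms by (cases n) auto
    have x: "0 < x" using assms that by simp
    have "((\<lambda>s. s ^ n) has_real_derivative real n * x ^ k) (at x)"
      using DERIV_pow[of n x] by (simp add: k)
    then have "((\<lambda>s. - (inverse (s ^ n))) has_real_derivative - (- (real n * x ^ k * inverse ((x ^ n) ^ Suc (Suc 0))))) (at x)"
      using x by (intro DERIV_minus DERIV_inverse_fun) auto
    moreover have "- (- (real n * x ^ k * inverse ((x ^ n) ^ Suc (Suc 0)))) = real n / x ^ Suc n"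
      using x by (simp add: k field_simps)
    ultimately show ?thesis
      by (simp add: inverse_eq_divide)
  qed
  ultimately show ?thesis
    using nn_integral_FTC_atLeast[of "\<lambda>s. real n / s ^ Suc n" a "\<lambda>s. - (1 / s ^ n)" 0] assms
    by simp
qed

text \<open>By the definition of the sphere measure, the right-hand side integrates \<open>h (r x / |x|)\<close> over \<open>r > 0\<close> and
  \<open>x\<close> in the punctured unit ball.  Rescaling first \<open>r = s |x|\<close> and then \<open>z = s x\<close> turns it into
  \<open>\<integral> h z |z|^n (\<integral>_(s \<ge> |z|) n s^(-n-1) ds) dz\<close>, whose inner integral is \<open>|z|^(-n)\<close>.\<close>

theorem nn_integral_polar:
  fixes h :: "'a::euclidean_space \<Rightarrow> ennreal"
  assumes h [measurable]: "h \<in> borel_measurable borel"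
  shows "(\<integral>\<^sup>+x. h x \<partial>lborel)
    = (\<integral>\<^sup>+r\<in>{0<..}. (\<integral>\<^sup>+\<theta>. h (r *\<^sub>R \<theta>) \<partial>sphere_measure) * ennreal (r ^ (DIM('a) - 1)) \<partial>lborel)"
proof -
  define n where "n = DIM('a)"
  have n: "0 < n" by (simp add: n_def)
  define D :: "'a set" where "D = cball 0 1 - {0}"
  have [measurable]: "D \<in> sets borel" by (simp add: D_def)
  \<comment> \<open>The same integrand in three sets of variables: \<open>Q\<close> in
    \<open>(r, x)\<close>, \<open>R\<close> after \<open>r = s * norm x\<close>, and
    \<open>T\<close> after \<open>z = s *\<^sub>R x\<close>. For \<open>s > 0\<close> the condition
    that \<open>x\<close> lies in \<open>D\<close> becomes \<open>norm z \<le> s\<close> and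
    \<open>z \<noteq> 0\<close>. The Jacobian \<open>norm x\<close> turns the factor
    \<open>norm x ^ (n - 1)\<close> coming from the weight into \<open>norm x ^ n\<close>.\<close>
  define Q where "Q = (\<lambda>r (x :: 'a). ennreal (real n) * h ((r / norm x) *\<^sub>R x) * indicator D x
      * ennreal (r ^ (n - 1)) * indicator {0<..} r)"
  define R where "R = (\<lambda>s (x :: 'a). ennreal (real n) * ennreal (norm x ^ n) * h (s *\<^sub>R x) * indicator D x
      * ennreal (s ^ (n - 1)) * indicator {0<..} s)"
  define T where "T = (\<lambda>s (z :: 'a). h z * ennreal (norm z ^ n) * ennreal (real n / s ^ Suc n)
      * of_bool (norm z \<le> s \<and> z \<noteq> 0))"
  have Q [measurable]: "case_prod Q \<in> borel_measurable (lborel \<Otimes>\<^sub>M lborel)"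
    unfolding Q_def by measurable
  have R [measurable]: "case_prod R \<in> borel_measurable (lborel \<Otimes>\<^sub>M lborel)"
    unfolding R_def by measurable
  have T [measurable]: "case_prod T \<in> borel_measurable (lborel \<Otimes>\<^sub>M lborel)"
    unfolding T_def of_bool_def by measurable
  have Q': "Q r \<in> borel_measurable lborel" "(\<lambda>r. Q r x) \<in> borel_measurable borel" for r x
    unfolding Q_def by measurable
  have "(\<integral>\<^sup>+r\<in>{0<..}. (\<integral>\<^sup>+\<theta>. h (r *\<^sub>R \<theta>) \<partial>sphere_measure) * ennreal (r ^ (DIM('a) - 1)) \<partial>lborel)
      = (\<integral>\<^sup>+r. (\<integral>\<^sup>+x. Q r x \<partial>lborel) \<partial>lborel)"
  proof (rule nn_integral_cong)
    fix r :: real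
    have "(\<integral>\<^sup>+\<theta>. h (r *\<^sub>R \<theta>) \<partial>sphere_measure) = ennreal (real n) * (\<integral>\<^sup>+x. h ((r / norm x) *\<^sub>R x) * indicator D x \<partial>lborel)"
      by (subst nn_integral_sphere_measure)
         (auto simp: n_def D_def divide_inverse ennreal_of_nat_eq_real_of_nat)
    then show "(\<integral>\<^sup>+\<theta>. h (r *\<^sub>R \<theta>) \<partial>sphere_measure) * ennreal (r ^ (DIM('a) - 1)) * indicator {0<..} r
        = (\<integral>\<^sup>+x. Q r x \<partial>lborel)"
      unfolding Q_def mult.assoc
      by (subst nn_integral_cmult, measurable, subst mult.assoc[symmetric], subst nn_integral_multc)
         (measurable, simp add: n_def mult.assoc)
  qed
  also have "\<dots> = (\<integral>\<^sup>+x. (\<integral>\<^sup>+r. Q r x \<partial>lborel) \<partial>lborel)"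
    by (rule lborel_pair.Fubini'[symmetric]) measurable
  also have "\<dots> = (\<integral>\<^sup>+x. (\<integral>\<^sup>+s. R s x \<partial>lborel) \<partial>lborel)"
  proof (rule nn_integral_cong)
    fix x :: 'a
    show "(\<integral>\<^sup>+r. Q r x \<partial>lborel) = (\<integral>\<^sup>+s. R s x \<partial>lborel)"
    proof (cases "x \<in> D")
      case True
      then have x: "0 < norm x" by (auto simp: D_def)
      have "(\<integral>\<^sup>+r. Q r x \<partial>lborel) = ennreal \<bar>norm x\<bar> * (\<integral>\<^sup>+s. Q (0 + norm x * s) x \<partial>lborel)"
        using x Q' by (intro nn_integral_real_affine) auto
      also have "\<dots> = (\<integral>\<^sup>+s. ennreal (norm x) * Q (norm x * s) x \<partial>lborel)"
        using Q' by (simp add: nn_integral_cmult)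
      also have "\<dots> = (\<integral>\<^sup>+s. R s x \<partial>lborel)"
      proof (rule nn_integral_cong)
        fix s :: real
        show "ennreal (norm x) * Q (norm x * s) x = R s x"
        proof (cases "0 < s")
          case True
          have "ennreal (norm x) * ennreal ((norm x * s) ^ (n - 1)) = ennreal (norm x ^ n) * ennreal (s ^ (n - 1))"
            using True n by (cases n) (auto simp: ennreal_mult[symmetric] power_mult_distrib)
          moreover have "ennreal (norm x) * Q (norm x * s) x = ennreal (real n) * h (s *\<^sub>R x) * indicator D x
              * (ennreal (norm x) * ennreal ((norm x * s) ^ (n - 1)))"
            using True x by (simp add: Q_def mult_ac)
          ultimately show ?thesis
            using True by (simp add: R_def mult_ac)
        qed (use x in \<open>simp add: Q_def R_def zero_less_mult_iff\<close>)
      qed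
      finally show ?thesis .
    next
      case False
      then show ?thesis by (simp add: Q_def R_def)
    qed
  qed
  also have "\<dots> = (\<integral>\<^sup>+s. (\<integral>\<^sup>+x. R s x \<partial>lborel) \<partial>lborel)"
    by (rule lborel_pair.Fubini') measurable
  also have "\<dots> = (\<integral>\<^sup>+s. (\<integral>\<^sup>+z. T s z \<partial>lborel) \<partial>lborel)"
  proof (rule nn_integral_cong)
    fix s :: real
    show "(\<integral>\<^sup>+x. R s x \<partial>lborel) = (\<integral>\<^sup>+z. T s z \<partial>lborel)"
    proof (cases "0 < s")
      case True
      have [measurable]: "T s \<in> borel_measurable borel"
        unfolding T_def of_bool_def by measurable
      have "(\<integral>\<^sup>+z. T s z \<partial>lborel) = ennreal (s ^ n) * (\<integral>\<^sup>+x. T s (s *\<^sub>R x) \<partial>lborel)"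
        using True unfolding n_def by (intro nn_integral_lborel_scaleR) auto
      also have "\<dots> = (\<integral>\<^sup>+x. ennreal (s ^ n) * T s (s *\<^sub>R x) \<partial>lborel)"
        by (simp add: nn_integral_cmult)
      also have "\<dots> = (\<integral>\<^sup>+x. R s x \<partial>lborel)"
      proof (rule nn_integral_cong)
        fix x :: 'a
        have ind: "of_bool (norm (s *\<^sub>R x) \<le> s \<and> s *\<^sub>R x \<noteq> 0) = (indicator D x :: ennreal)"
          using True by (auto simp: indicator_def D_def)
        have eq: "ennreal (s ^ n) * (ennreal (norm (s *\<^sub>R x) ^ n) * ennreal (real n / s ^ Suc n))
            = ennreal (real n) * ennreal (norm x ^ n) * ennreal (s ^ (n - 1))"
        proof -
          have "s ^ n * ((s * norm x) ^ n * (real n / s ^ Suc n)) = real n * norm x ^ n * s ^ (n - 1)"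
            using True n by (cases n) (auto simp: power_mult_distrib field_simps)
          then show ?thesis
            using True by (simp add: ennreal_mult[symmetric])
        qed
        have "ennreal (s ^ n) * T s (s *\<^sub>R x) = h (s *\<^sub>R x)
            * (ennreal (s ^ n) * (ennreal (norm (s *\<^sub>R x) ^ n) * ennreal (real n / s ^ Suc n)))
            * (of_bool (norm (s *\<^sub>R x) \<le> s \<and> s *\<^sub>R x \<noteq> 0))"
          by (simp add: T_def mult_ac)
        also have "\<dots> = R s x"
          unfolding eq ind using True by (simp add: R_def mult_ac)
        finally show "ennreal (s ^ n) * T s (s *\<^sub>R x) = R s x" .
      qed
      finally show ?thesis ..
    next
      case False
      then have "\<not> (norm z \<le> s \<and> z \<noteq> 0)" for z :: 'a
        using zero_less_norm_iff[of z] by linarith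
      then have "T s z = 0" for z
        by (simp add: T_def)
      then show ?thesis using False by (simp add: R_def)
    qed
  qed
  also have "\<dots> = (\<integral>\<^sup>+z. (\<integral>\<^sup>+s. T s z \<partial>lborel) \<partial>lborel)"
    by (rule lborel_pair.Fubini'[symmetric]) measurable
  also have "\<dots> = (\<integral>\<^sup>+z. h z \<partial>lborel)"
  proof (intro nn_integral_cong_AE)
    \<comment> \<open>The origin is excluded because \<open>T s 0\<close> is 0 for every
      \<open>s\<close>, whatever \<open>h 0\<close> is.\<close>
    show "AE z in lborel. (\<integral>\<^sup>+s. T s z \<partial>lborel) = h z"
      using AE_lborel_neq[of 0]
    proof eventually_elim
      case (elim z)
      have "(\<integral>\<^sup>+s. T s z \<partial>lborel) = (\<integral>\<^sup>+s. h z * ennreal (norm z ^ n)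
          * (ennreal (real n / s ^ Suc n) * indicator {norm z..} s) \<partial>lborel)"
        using elim by (intro nn_integral_cong) (simp add: T_def mult_ac indicator_def)
      also have "\<dots> = h z * ennreal (norm z ^ n) * ennreal (1 / norm z ^ n)"
        using elim n by (subst nn_integral_cmult) (auto simp del: power_Suc simp: nn_integral_inverse_power_tail)
      also have "\<dots> = h z"
        using elim by (simp add: mult.assoc ennreal_mult[symmetric])
      finally show ?case .
    qed
  qed
  finally show ?thesis ..
qed

section \<open>Null sets in polar coordinates\<close>

text \<open>The exceptional set lies in a Borel null set \<open>N\<close>. The polar coordinate
  formula for its indicator gives an integral over \<open>r\<close> that is 0, and the weight
  \<open>r ^ (DIM('a) - 1)\<close> is positive for \<open>r > 0\<close>, so almost every sphere
  meets \<open>N\<close> in a set of surface measure 0.\<close>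

lemma AE_polar:
  fixes P :: "'a::euclidean_space \<Rightarrow> bool"
  assumes "AE x in lborel. P x"
  shows "AE r in lborel. 0 < r \<longrightarrow> (AE \<theta> in sphere_measure. P (r *\<^sub>R \<theta>))"
proof -
  obtain N where N: "N \<in> null_sets lborel" "\<And>x. x \<notin> N \<Longrightarrow> P x"
    using AE_E3[OF assms] by auto
  then have [measurable]: "N \<in> sets borel" by auto
  have meas [measurable]: "(\<lambda>\<theta>. indicator N (r *\<^sub>R \<theta>) :: ennreal) \<in> borel_measurable sphere_measure" for r
    by (rule measurable_polar) auto
  interpret pair_sigma_finite "lborel :: real measure" "sphere_measure :: 'a measure"
    by (rule pair_sigma_finite_lborel_sphere_measure)
  have "0 = (\<integral>\<^sup>+x. indicator N x \<partial>lborel)"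
    using N by auto
  also have "\<dots> = (\<integral>\<^sup>+r\<in>{0<..}. (\<integral>\<^sup>+\<theta>. indicator N (r *\<^sub>R \<theta>) \<partial>sphere_measure) * ennreal (r ^ (DIM('a) - 1)) \<partial>lborel)"
    by (rule nn_integral_polar) measurable
  finally have "AE r in lborel. (\<integral>\<^sup>+\<theta>. indicator N (r *\<^sub>R \<theta>) \<partial>(sphere_measure :: 'a measure))
      * ennreal (r ^ (DIM('a) - 1)) * indicator {0<..} r = 0"
    by (subst (asm) eq_commute, subst (asm) nn_integral_0_iff_AE) auto
  then show ?thesis
  proof eventually_elim
    case (elim r)
    show ?case
    proof
      assume r: "0 < r"
      then have "(\<integral>\<^sup>+\<theta>. indicator N (r *\<^sub>R \<theta>) \<partial>(sphere_measure :: 'a measure)) = 0"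
        using elim zero_less_power[OF r, of "DIM('a) - 1"] by (auto simp: ennreal_eq_0_iff not_le[symmetric])
      then have "AE \<theta> in sphere_measure. (indicator N (r *\<^sub>R \<theta>) :: ennreal) = 0"
        by (subst (asm) nn_integral_0_iff_AE) auto
      then show "AE \<theta> in sphere_measure. P (r *\<^sub>R \<theta>)"
        by eventually_elim (use N in \<open>auto simp: indicator_def split: if_splits\<close>)
    qed
  qed
qed

text \<open>Fubini exchanges the quantifiers in \<open>AE_polar\<close>, so almost every direction
  is good. As the sphere has positive measure, at least one good direction exists. The exchange
  needs a measurable set and is therefore made for the Borel null set \<open>N\<close> instead of
  \<open>P\<close>.\<close>

lemma AE_ray:
  fixes P :: "'a::euclidean_space \<Rightarrow> bool"
  assumes "AE x in lborel. P x"
  shows "\<exists>\<theta>. norm \<theta> = 1 \<and> (AE r in lborel. 0 < r \<longrightarrow> P (r *\<^sub>R \<theta>))"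
proof -
  obtain N where N: "N \<in> null_sets lborel" "\<And>x. x \<notin> N \<Longrightarrow> P x"
    using AE_E3[OF assms] by auto
  then have [measurable]: "N \<in> sets borel" by auto
  interpret pair_sigma_finite "lborel :: real measure" "sphere_measure :: 'a measure"
    by (rule pair_sigma_finite_lborel_sphere_measure)
  have [measurable]: "(\<lambda>x. fst x *\<^sub>R snd x) \<in> lborel \<Otimes>\<^sub>M (sphere_measure :: 'a measure) \<rightarrow>\<^sub>M borel"
    by (rule measurable_polar[of "\<lambda>x. x"]) auto
  have "AE x in lborel. x \<notin> N"
    using N by (simp add: AE_not_in)
  then have "AE r in lborel. AE \<theta> in (sphere_measure :: 'a measure). 0 < r \<longrightarrow> r *\<^sub>R \<theta> \<notin> N"
    using AE_polar[of "\<lambda>x. x \<notin> N"] by auto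
  then have "AE \<theta> in (sphere_measure :: 'a measure). AE r in lborel. 0 < r \<longrightarrow> r *\<^sub>R \<theta> \<notin> N"
    by (subst (asm) AE_commute) measurable
  then have "\<exists>\<theta>\<in>space (sphere_measure :: 'a measure). AE r in lborel. 0 < r \<longrightarrow> r *\<^sub>R \<theta> \<notin> N"
  proof (rule contrapos_pp)
    assume "\<not> (\<exists>\<theta>\<in>space (sphere_measure :: 'a measure). AE r in lborel. 0 < r \<longrightarrow> r *\<^sub>R \<theta> \<notin> N)"
    then have "(AE \<theta> in (sphere_measure :: 'a measure). AE r in lborel. 0 < r \<longrightarrow> r *\<^sub>R \<theta> \<notin> N)
        \<longleftrightarrow> (AE \<theta> in (sphere_measure :: 'a measure). False)"
      by (intro AE_cong) auto
    moreover have "\<not> (AE \<theta> in (sphere_measure :: 'a measure). False)"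
    proof
      assume "AE \<theta> in (sphere_measure :: 'a measure). False"
      then have "space (sphere_measure :: 'a measure) \<in> null_sets sphere_measure"
        using AE_iff_null[of sphere_measure "\<lambda>_ :: 'a. False"] sets.top[of "sphere_measure :: 'a measure"]
        by (simp del: space_sphere_measure)
      then show False
        using emeasure_sphere_measure_sphere_neq_0[where 'a='a] by auto
    qed
    ultimately show "\<not> (AE \<theta> in (sphere_measure :: 'a measure). AE r in lborel. 0 < r \<longrightarrow> r *\<^sub>R \<theta> \<notin> N)"
      by simp
  qed
  then obtain \<theta> :: 'a where "norm \<theta> = 1" and ae: "AE r in lborel. 0 < r \<longrightarrow> r *\<^sub>R \<theta> \<notin> N"
    by auto
  moreover have "AE r in lborel. 0 < r \<longrightarrow> P (r *\<^sub>R \<theta>)"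
    using ae by eventually_elim (use N in auto)
  ultimately show ?thesis by blast
qed

text \<open>Converse passage, from radii to points: the polar coordinate formula is applied to the
  indicator of \<open>N\<close> composed with the norm, which is constant on each sphere.\<close>

lemma AE_norm:
  fixes P :: "real \<Rightarrow> bool"
  assumes "AE r in lborel. 0 < r \<longrightarrow> P r"
  shows "AE x in (lborel :: 'a::euclidean_space measure). x \<noteq> 0 \<longrightarrow> P (norm x)"
proof -
  obtain N where N: "N \<in> null_sets lborel" "\<And>r. r \<notin> N \<Longrightarrow> 0 < r \<longrightarrow> P r"
    using AE_E3[OF assms] by auto
  then have [measurable]: "N \<in> sets borel" by auto
  have "(\<integral>\<^sup>+x. indicator N (norm x) \<partial>(lborel :: 'a measure))
      = (\<integral>\<^sup>+r\<in>{0<..}. (\<integral>\<^sup>+\<theta>. indicator N (norm (r *\<^sub>R \<theta>)) \<partial>(sphere_measure :: 'a measure)) * ennreal (r ^ (DIM('a) - 1)) \<partial>lborel)"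
    by (rule nn_integral_polar) measurable
  also have "\<dots> = (\<integral>\<^sup>+(r::real). 0 \<partial>lborel)"
  proof (intro nn_integral_cong_AE)
    have "AE r in lborel. r \<notin> N" using N by (simp add: AE_not_in)
    then show "AE r in lborel. (\<integral>\<^sup>+\<theta>. indicator N (norm (r *\<^sub>R \<theta>)) \<partial>(sphere_measure :: 'a measure))
        * ennreal (r ^ (DIM('a) - 1)) * indicator {0<..} r = 0"
    proof eventually_elim
      case (elim r)
      have "(\<integral>\<^sup>+\<theta>. indicator N (norm (r *\<^sub>R \<theta>)) \<partial>(sphere_measure :: 'a measure)) = (\<integral>\<^sup>+(\<theta>::'a). 0 \<partial>sphere_measure)" if "0 < r"
        using that elim by (intro nn_integral_cong) auto
      then show ?case by (cases "0 < r") auto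
    qed
  qed
  finally have "(\<integral>\<^sup>+x. indicator N (norm x) \<partial>(lborel :: 'a measure)) = 0"
    by simp
  then have "AE x in (lborel :: 'a measure). (indicator N (norm x) :: ennreal) = 0"
    by (subst (asm) nn_integral_0_iff_AE) auto
  then show ?thesis
    by eventually_elim (use N in \<open>auto simp: indicator_def split: if_splits\<close>)
qed

text \<open>The map \<open>r \<mapsto> c / r\<close> is differentiable on the positive half-line and
  so carries null sets to null sets. It is its own inverse, so the image of \<open>N\<close> is also
  the preimage.\<close>

lemma AE_inverse:
  fixes P :: "real \<Rightarrow> bool" and c :: real
  assumes "AE r in lborel. 0 < r \<longrightarrow> P r" and c: "0 < c"
  shows "AE r in lborel. 0 < r \<longrightarrow> P (c / r)"
proof -
  obtain N where N: "N \<in> null_sets lborel" "\<And>r. r \<notin> N \<Longrightarrow> 0 < r \<longrightarrow> P r"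
    using AE_E3[OF assms(1)] by auto
  have "negligible (N \<inter> {0<..})"
    using N(1) by (metis negligible_iff_null_sets negligible_Int null_sets_completionI)
  then have "negligible ((\<lambda>r. c / r) ` (N \<inter> {0<..}))"
    by (rule negligible_differentiable_image_negligible[OF order_refl])
       (auto intro!: differentiable_at_imp_differentiable_on derivative_intros)
  then have "AE r in lebesgue. r \<notin> (\<lambda>r. c / r) ` (N \<inter> {0<..})"
    by (intro AE_not_in) (simp add: negligible_iff_null_sets)
  then have "AE r in lborel. r \<notin> (\<lambda>r. c / r) ` (N \<inter> {0<..})"
    by (simp add: AE_completion_iff)
  then show ?thesis
  proof eventually_elim
    case (elim r)
    show ?case
    proof
      assume r: "0 < r"
      have "r = c / (c / r)" using r c by simp
      then have "c / r \<notin> N" using elim r c by (metis (no_types, lifting) IntI divide_pos_pos greaterThan_iff image_eqI)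
      then show "P (c / r)" using N r c by auto
    qed
  qed
qed

section \<open>Functions of several vectors\<close>

lemma measurable_vec_nth [measurable]: "(\<lambda>y :: 'a::euclidean_space^'m. y $ i) \<in> borel \<rightarrow>\<^sub>M borel"
  by (intro borel_measurable_continuous_onI continuous_intros)

lemma measurable_vec_lambda_PiM:
  "(\<lambda>f. \<chi> i. f i) \<in> (\<Pi>\<^sub>M i\<in>(UNIV :: 'm::finite set). (lborel :: 'a::euclidean_space measure)) \<rightarrow>\<^sub>M borel"
proof (subst borel_measurable_euclidean_space, intro ballI)
  fix b :: "'a^'m" assume "b \<in> Basis"
  then obtain i u where b: "b = axis i u" by (auto simp: Basis_vec_def)
  have "(\<lambda>f. (f :: 'm \<Rightarrow> 'a) i \<bullet> u) \<in> borel_measurable (\<Pi>\<^sub>M i\<in>(UNIV :: 'm set). (lborel :: 'a measure))"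
    by measurable
  then show "(\<lambda>f. (\<chi> i. f i) \<bullet> b) \<in> borel_measurable (\<Pi>\<^sub>M i\<in>(UNIV :: 'm set). (lborel :: 'a measure))"
    by (simp add: b inner_axis)
qed

lemma prod_Basis_vec:
  "(\<Prod>b\<in>(Basis :: ('a::euclidean_space^'m) set). g b) = (\<Prod>i\<in>UNIV. \<Prod>u\<in>Basis. g (axis i u))"
proof -
  have B: "Basis = (\<lambda>(i, u). axis i u) ` (UNIV \<times> (Basis :: 'a set))" (is "_ = _ ` ?A")
    by (auto simp: Basis_vec_def)
  have inj: "inj_on (\<lambda>(i, u). axis i u :: 'a^'m) ?A"
    by (auto simp: inj_on_def axis_eq_axis nonzero_Basis)
  show ?thesis
    unfolding B prod.reindex[OF inj] prod.cartesian_product by (simp add: split_beta' comp_def)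
qed

lemma mem_box_vec: "y \<in> box l u \<longleftrightarrow> (\<forall>i. y $ i \<in> box (l $ i) (u $ i))"
  for y :: "'a::euclidean_space^'m"
  by (auto simp: mem_box Basis_vec_def inner_axis)

lemma product_sigma_finite_lborel: "product_sigma_finite (\<lambda>i. lborel :: 'a::euclidean_space measure)"
  by (simp add: product_sigma_finite.intro sigma_finite_lborel)

text \<open>Lebesgue measure is determined by the volumes of boxes, and a box in
  \<open>'a^'m\<close> is the product of its component boxes. On the product measure the components
  can be treated one at a time.\<close>

lemma lborel_vec:
  "(lborel :: ('a::euclidean_space^'m) measure)
     = distr (\<Pi>\<^sub>M i\<in>(UNIV :: 'm set). (lborel :: 'a measure)) borel (\<lambda>f. \<chi> i. f i)"
proof (rule lborel_eqI)
  interpret product_sigma_finite "\<lambda>i::'m. lborel :: 'a measure"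
    by (rule product_sigma_finite_lborel)
  fix l u :: "'a^'m" assume le: "\<And>b. b \<in> Basis \<Longrightarrow> l \<bullet> b \<le> u \<bullet> b"
  have le': "l $ i \<bullet> b \<le> u $ i \<bullet> b" if "b \<in> Basis" for i b
    using le[of "axis i b"] that by (auto simp: inner_axis Basis_vec_def)
  have "emeasure (distr (\<Pi>\<^sub>M i\<in>(UNIV :: 'm set). (lborel :: 'a measure)) borel (\<lambda>f. \<chi> i. f i)) (box l u)
      = emeasure (\<Pi>\<^sub>M i\<in>(UNIV :: 'm set). (lborel :: 'a measure)) (\<Pi>\<^sub>E i\<in>UNIV. box (l $ i) (u $ i))"
    by (subst emeasure_distr[OF measurable_vec_lambda_PiM])
       (auto simp: mem_box_vec space_PiM PiE_def Pi_def extensional_def intro!: arg_cong2[where f=emeasure])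
  also have "\<dots> = (\<Prod>i\<in>UNIV. emeasure lborel (box (l $ i) (u $ i)))"
    by (subst emeasure_PiM) auto
  also have "\<dots> = (\<Prod>i\<in>UNIV. ennreal (\<Prod>b\<in>Basis. (u $ i - l $ i) \<bullet> b))"
    using le' by (intro prod.cong refl emeasure_lborel_box) auto
  also have "\<dots> = ennreal (\<Prod>i\<in>UNIV. \<Prod>b\<in>Basis. (u $ i - l $ i) \<bullet> b)"
    using le' by (intro prod_ennreal prod_nonneg) (auto simp: inner_diff_left)
  also have "\<dots> = ennreal (\<Prod>b\<in>Basis. (u - l) \<bullet> b)"
    by (subst prod_Basis_vec) (simp add: inner_axis)
  finally show "emeasure (distr (\<Pi>\<^sub>M i\<in>(UNIV :: 'm set). (lborel :: 'a measure)) borel (\<lambda>f. \<chi> i. f i)) (box l u)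
      = ennreal (\<Prod>b\<in>Basis. (u - l) \<bullet> b)" .
qed simp

lemma nn_integral_lborel_vec:
  fixes h :: "'a::euclidean_space^'m \<Rightarrow> ennreal"
  assumes "h \<in> borel_measurable borel"
  shows "(\<integral>\<^sup>+y. h y \<partial>lborel) = (\<integral>\<^sup>+f. h (\<chi> i. f i) \<partial>(\<Pi>\<^sub>M i\<in>UNIV. lborel))"
  by (subst lborel_vec, subst nn_integral_distr[OF measurable_vec_lambda_PiM]) (simp_all add: assms)

text \<open>The preimage of \<open>N\<close> under the projection is a product with \<open>N\<close>
  in place \<open>i\<close> and the whole space elsewhere. Its measure is a product with one factor
  0, and the infinite other factors do no harm since \<open>0 * top = 0\<close>.\<close>

lemma AE_vec_nth:
  fixes P :: "'a::euclidean_space \<Rightarrow> bool"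
  assumes "AE x in lborel. P x"
  shows "AE y in (lborel :: ('a^'m) measure). P (y $ i)"
proof -
  interpret product_sigma_finite "\<lambda>i::'m. lborel :: 'a measure"
    by (rule product_sigma_finite_lborel)
  obtain N where N: "N \<in> null_sets lborel" "\<And>x. x \<notin> N \<Longrightarrow> P x"
    using AE_E3[OF assms] by auto
  then have [measurable]: "N \<in> sets borel" by auto
  have "(\<integral>\<^sup>+y. indicator N (y $ i) \<partial>(lborel :: ('a^'m) measure))
      = (\<integral>\<^sup>+f. indicator N (f i) \<partial>(\<Pi>\<^sub>M i\<in>(UNIV :: 'm set). (lborel :: 'a measure)))"
    by (subst nn_integral_lborel_vec) auto
  also have "\<dots> = (\<integral>\<^sup>+f. (\<Prod>j\<in>UNIV. indicator (if j = i then N else UNIV) (f j)) \<partial>(\<Pi>\<^sub>M i\<in>(UNIV :: 'm set). (lborel :: 'a measure)))"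
    by (subst prod.remove[of UNIV i]) (auto intro!: nn_integral_cong)
  also have "\<dots> = (\<Prod>j\<in>(UNIV :: 'm set). \<integral>\<^sup>+x. indicator (if j = i then N else UNIV) x \<partial>(lborel :: 'a measure))"
    by (rule product_nn_integral_prod) auto
  also have "\<dots> = 0"
    using N(1) by (intro prod_zero bexI[of _ i]) auto
  finally have "AE y in (lborel :: ('a^'m) measure). (indicator N (y $ i) :: ennreal) = 0"
    by (subst (asm) nn_integral_0_iff_AE) auto
  then show ?thesis
    by eventually_elim (use N in \<open>auto simp: indicator_def split: if_splits\<close>)
qed

section \<open>Replacing functions by spherical averages\<close>

text \<open>On each sphere the radial weight \<open>w\<close> is constant and leaves the angular
  integral, so comparing the sphere integrals of \<open>h\<close> and \<open>k\<close> is enough.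
  The constant \<open>k r\<close> appears integrated over the sphere so that both sides have the
  same shape.\<close>

lemma nn_integral_radial_mono:
  fixes w h :: "'a::euclidean_space \<Rightarrow> ennreal" and k :: "real \<Rightarrow> ennreal"
  assumes [measurable]: "w \<in> borel_measurable borel" "h \<in> borel_measurable borel" "k \<in> borel_measurable borel"
    and w: "\<And>x y. norm x = norm y \<Longrightarrow> w x = w y"
    and le: "\<And>r. 0 < r \<Longrightarrow> (\<integral>\<^sup>+\<theta>. h (r *\<^sub>R \<theta>) \<partial>(sphere_measure :: 'a measure)) \<le> (\<integral>\<^sup>+\<theta>. k r \<partial>(sphere_measure :: 'a measure))"
  shows "(\<integral>\<^sup>+x. w x * h x \<partial>lborel) \<le> (\<integral>\<^sup>+x. w x * k (norm x) \<partial>lborel)"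
proof -
  have pull: "(\<integral>\<^sup>+\<theta>. w (r *\<^sub>R \<theta>) * g (r *\<^sub>R \<theta>) \<partial>sphere_measure) = w (r *\<^sub>R e) * (\<integral>\<^sup>+\<theta>. g (r *\<^sub>R \<theta>) \<partial>sphere_measure)"
    if e: "norm e = 1" and g: "g \<in> borel_measurable borel" for g and r and e :: 'a
  proof -
    have "(\<integral>\<^sup>+\<theta>. w (r *\<^sub>R \<theta>) * g (r *\<^sub>R \<theta>) \<partial>sphere_measure) = (\<integral>\<^sup>+\<theta>. w (r *\<^sub>R e) * g (r *\<^sub>R \<theta>) \<partial>sphere_measure)"
    proof (rule nn_integral_cong)
      fix \<theta> :: 'a assume "\<theta> \<in> space sphere_measure"
      then have "w (r *\<^sub>R \<theta>) = w (r *\<^sub>R e)"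
        by (intro w) (simp add: e)
      then show "w (r *\<^sub>R \<theta>) * g (r *\<^sub>R \<theta>) = w (r *\<^sub>R e) * g (r *\<^sub>R \<theta>)" by simp
    qed
    also have "\<dots> = w (r *\<^sub>R e) * (\<integral>\<^sup>+\<theta>. g (r *\<^sub>R \<theta>) \<partial>sphere_measure)"
      by (rule nn_integral_cmult, rule measurable_polar[OF g]) auto
    finally show ?thesis .
  qed
  obtain e :: 'a where e: "norm e = 1"
    using vector_choose_size[of 1] by auto
  have "(\<integral>\<^sup>+x. w x * h x \<partial>lborel) = (\<integral>\<^sup>+r\<in>{0<..}. (\<integral>\<^sup>+\<theta>. w (r *\<^sub>R \<theta>) * h (r *\<^sub>R \<theta>) \<partial>(sphere_measure :: 'a measure)) * ennreal (r ^ (DIM('a) - 1)) \<partial>lborel)"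
    by (rule nn_integral_polar) measurable
  also have "\<dots> \<le> (\<integral>\<^sup>+r\<in>{0<..}. (\<integral>\<^sup>+\<theta>. w (r *\<^sub>R \<theta>) * k (norm (r *\<^sub>R \<theta>)) \<partial>(sphere_measure :: 'a measure)) * ennreal (r ^ (DIM('a) - 1)) \<partial>lborel)"
  proof (rule nn_integral_mono)
    fix r :: real
    have "(\<integral>\<^sup>+\<theta>. w (r *\<^sub>R \<theta>) * h (r *\<^sub>R \<theta>) \<partial>(sphere_measure :: 'a measure)) \<le> (\<integral>\<^sup>+\<theta>. w (r *\<^sub>R \<theta>) * k (norm (r *\<^sub>R \<theta>)) \<partial>(sphere_measure :: 'a measure))" if r: "0 < r"
    proof -
      have "(\<integral>\<^sup>+\<theta>. k (norm (r *\<^sub>R \<theta>)) \<partial>(sphere_measure :: 'a measure)) = (\<integral>\<^sup>+\<theta>. k r \<partial>(sphere_measure :: 'a measure))"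
        using r by (intro nn_integral_cong) auto
      then show ?thesis
        using le[OF r] by (subst (1 2) pull[OF e]) (auto intro!: mult_left_mono)
    qed
    then show "(\<integral>\<^sup>+\<theta>. w (r *\<^sub>R \<theta>) * h (r *\<^sub>R \<theta>) \<partial>(sphere_measure :: 'a measure)) * ennreal (r ^ (DIM('a) - 1)) * indicator {0<..} r
        \<le> (\<integral>\<^sup>+\<theta>. w (r *\<^sub>R \<theta>) * k (norm (r *\<^sub>R \<theta>)) \<partial>(sphere_measure :: 'a measure)) * ennreal (r ^ (DIM('a) - 1)) * indicator {0<..} r"
      by (cases "0 < r") (auto intro!: mult_right_mono)
  qed
  also have "\<dots> = (\<integral>\<^sup>+x. w x * k (norm x) \<partial>lborel)"
    by (rule nn_integral_polar[symmetric]) measurable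
  finally show ?thesis .
qed

text \<open>Induction on the index set, one component being averaged at each stage. The weight is
  arbitrary in the induction because fixing a component \<open>x\<close> leaves the weight
  \<open>w (y(i := x))\<close> in the remaining ones.\<close>

lemma nn_integral_PiM_radial_mono:
  fixes h :: "'i \<Rightarrow> 'a::euclidean_space \<Rightarrow> ennreal" and k :: "'i \<Rightarrow> real \<Rightarrow> ennreal"
  assumes "finite I"
    and "w \<in> borel_measurable (\<Pi>\<^sub>M i\<in>I. (lborel :: 'a measure))"
    and "\<And>x y. (\<And>i. i \<in> I \<Longrightarrow> norm (x i) = norm (y i)) \<Longrightarrow> w x = w y"
    and h [measurable]: "\<And>i. h i \<in> borel_measurable borel" and k [measurable]: "\<And>i. k i \<in> borel_measurable borel"
    and le: "\<And>i r. 0 < r \<Longrightarrow> (\<integral>\<^sup>+\<theta>. h i (r *\<^sub>R \<theta>) \<partial>(sphere_measure :: 'a measure)) \<le> (\<integral>\<^sup>+\<theta>. k i r \<partial>(sphere_measure :: 'a measure))"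
  shows "(\<integral>\<^sup>+y. w y * (\<Prod>i\<in>I. h i (y i)) \<partial>(\<Pi>\<^sub>M i\<in>I. lborel))
    \<le> (\<integral>\<^sup>+y. w y * (\<Prod>i\<in>I. k i (norm (y i))) \<partial>(\<Pi>\<^sub>M i\<in>I. lborel))"
  using assms(1-3)
proof (induction I arbitrary: w rule: finite_induct)
  case empty
  show ?case by simp
next
  case (insert i I)
  interpret product_sigma_finite "\<lambda>i::'i. lborel :: 'a measure"
    by (rule product_sigma_finite_lborel)
  interpret I: finite_product_sigma_finite "\<lambda>i::'i. lborel :: 'a measure" I
    by standard (rule insert)
  interpret P: pair_sigma_finite "\<Pi>\<^sub>M i\<in>I. (lborel :: 'a measure)" "lborel :: 'a measure"
    by (intro pair_sigma_finite.intro I.sigma_finite_measure_axioms sigma_finite_lborel)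
  note [measurable] = insert.prems(1)
  have upd [measurable]: "(\<lambda>(y, x). y(i := x)) \<in> (\<Pi>\<^sub>M i\<in>I. (lborel :: 'a measure)) \<Otimes>\<^sub>M lborel \<rightarrow>\<^sub>M (\<Pi>\<^sub>M i\<in>insert i I. lborel)"
    using measurable_add_dim[of i I "\<lambda>_. lborel :: 'a measure"] by (simp add: case_prod_beta')
  have w_upd [measurable]: "(\<lambda>(y, x). w (y(i := x))) \<in> borel_measurable ((\<Pi>\<^sub>M i\<in>I. (lborel :: 'a measure)) \<Otimes>\<^sub>M lborel)"
    using measurable_compose[OF upd insert.prems(1)] by (simp add: case_prod_beta')
  have w_upd1: "(\<lambda>x. w (y(i := x))) \<in> borel_measurable lborel" if "y \<in> space (\<Pi>\<^sub>M i\<in>I. (lborel :: 'a measure))" for y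
    using measurable_compose[OF measurable_Pair1'[OF that] w_upd] by simp
  have w_upd2 [measurable]: "(\<lambda>y. w (y(i := x))) \<in> borel_measurable (\<Pi>\<^sub>M i\<in>I. (lborel :: 'a measure))" for x
    using measurable_compose[OF measurable_Pair2'[of x lborel] w_upd] by simp
  have prod_upd: "(\<Prod>j\<in>I. g j (if j = i then x else y j)) = (\<Prod>j\<in>I. g j (y j))" for g :: "'i \<Rightarrow> 'a \<Rightarrow> ennreal" and y x
    using insert.hyps by (intro prod.cong) auto
  have "(\<integral>\<^sup>+y. w y * (\<Prod>j\<in>insert i I. h j (y j)) \<partial>(\<Pi>\<^sub>M i\<in>insert i I. lborel))
      = (\<integral>\<^sup>+y. (\<integral>\<^sup>+x. (w (y(i := x)) * (\<Prod>j\<in>I. h j (y j))) * h i x \<partial>lborel) \<partial>(\<Pi>\<^sub>M i\<in>I. lborel))"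
    using insert.hyps by (subst product_nn_integral_insert) (auto simp: prod_upd mult_ac)
  \<comment> \<open>For fixed \<open>y\<close> the factors \<open>h j (y j)\<close> do not depend on
    \<open>x\<close> and join the weight, which stays radial in \<open>x\<close>.\<close>
  also have "\<dots> \<le> (\<integral>\<^sup>+y. (\<integral>\<^sup>+x. (w (y(i := x)) * (\<Prod>j\<in>I. h j (y j))) * k i (norm x) \<partial>lborel) \<partial>(\<Pi>\<^sub>M i\<in>I. lborel))"
  proof (rule nn_integral_mono)
    fix y :: "'i \<Rightarrow> 'a" assume y: "y \<in> space (\<Pi>\<^sub>M i\<in>I. lborel)"
    show "(\<integral>\<^sup>+x. (w (y(i := x)) * (\<Prod>j\<in>I. h j (y j))) * h i x \<partial>lborel)
        \<le> (\<integral>\<^sup>+x. (w (y(i := x)) * (\<Prod>j\<in>I. h j (y j))) * k i (norm x) \<partial>lborel)"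
    proof (rule nn_integral_radial_mono)
      show "(\<lambda>x. w (y(i := x)) * (\<Prod>j\<in>I. h j (y j))) \<in> borel_measurable borel"
        using w_upd1[OF y] by simp
      show "w (y(i := x)) * (\<Prod>j\<in>I. h j (y j)) = w (y(i := x')) * (\<Prod>j\<in>I. h j (y j))" if "norm x = norm x'" for x x'
      proof -
        have "w (y(i := x)) = w (y(i := x'))"
          by (rule insert.prems(2)) (simp add: that)
        then show ?thesis by simp
      qed
    qed (use le in auto)
  qed
  \<comment> \<open>The order of integration is reversed so that the induction hypothesis can be
    applied for each fixed \<open>x\<close>.\<close>
  also have "\<dots> = (\<integral>\<^sup>+x. (\<integral>\<^sup>+y. (w (y(i := x)) * (\<Prod>j\<in>I. h j (y j))) * k i (norm x) \<partial>(\<Pi>\<^sub>M i\<in>I. lborel)) \<partial>lborel)"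
    by (rule P.Fubini'[symmetric]) measurable
  also have "\<dots> = (\<integral>\<^sup>+x. (\<integral>\<^sup>+y. w (y(i := x)) * (\<Prod>j\<in>I. h j (y j)) \<partial>(\<Pi>\<^sub>M i\<in>I. lborel)) * k i (norm x) \<partial>lborel)"
    by (intro nn_integral_cong nn_integral_multc) measurable
  also have "\<dots> \<le> (\<integral>\<^sup>+x. (\<integral>\<^sup>+y. w (y(i := x)) * (\<Prod>j\<in>I. k j (norm (y j))) \<partial>(\<Pi>\<^sub>M i\<in>I. lborel)) * k i (norm x) \<partial>lborel)"
  proof (rule nn_integral_mono, rule mult_right_mono, rule insert.IH)
    show "w (y(i := x)) = w (y'(i := x))" if "\<And>j. j \<in> I \<Longrightarrow> norm (y j) = norm (y' j)" for x y y'
      by (rule insert.prems(2)) (use that in auto)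
  qed (rule w_upd2, simp)
  also have "\<dots> = (\<integral>\<^sup>+x. (\<integral>\<^sup>+y. (w (y(i := x)) * (\<Prod>j\<in>I. k j (norm (y j)))) * k i (norm x) \<partial>(\<Pi>\<^sub>M i\<in>I. lborel)) \<partial>lborel)"
    by (intro nn_integral_cong nn_integral_multc[symmetric]) measurable
  also have "\<dots> = (\<integral>\<^sup>+y. w y * (\<Prod>j\<in>insert i I. k j (norm (y j))) \<partial>(\<Pi>\<^sub>M i\<in>insert i I. lborel))"
    using insert.hyps by (subst product_nn_integral_insert_rev) (auto simp: prod_upd[of "\<lambda>j x. k j (norm x)"] mult_ac)
  finally show ?case .
qed

lemma nn_integral_vec_radial_mono:
  fixes h :: "'m::finite \<Rightarrow> 'a::euclidean_space \<Rightarrow> ennreal" and k :: "'m \<Rightarrow> real \<Rightarrow> ennreal"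
  assumes w [measurable]: "w \<in> borel_measurable borel"
    and w_radial: "\<And>x y :: 'a^'m. (\<And>i. norm (x $ i) = norm (y $ i)) \<Longrightarrow> w x = w y"
    and [measurable]: "\<And>i. h i \<in> borel_measurable borel" "\<And>i. k i \<in> borel_measurable borel"
    and le: "\<And>i r. 0 < r \<Longrightarrow> (\<integral>\<^sup>+\<theta>. h i (r *\<^sub>R \<theta>) \<partial>(sphere_measure :: 'a measure)) \<le> (\<integral>\<^sup>+\<theta>. k i r \<partial>(sphere_measure :: 'a measure))"
  shows "(\<integral>\<^sup>+y. w y * (\<Prod>i\<in>UNIV. h i (y $ i)) \<partial>lborel) \<le> (\<integral>\<^sup>+y. w y * (\<Prod>i\<in>UNIV. k i (norm (y $ i))) \<partial>lborel)"
proof -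
  have "(\<lambda>f. w (\<chi> i. f i)) \<in> borel_measurable (\<Pi>\<^sub>M i\<in>(UNIV :: 'm set). (lborel :: 'a measure))"
    by (rule measurable_compose[OF measurable_vec_lambda_PiM w])
  then have "(\<integral>\<^sup>+f. w (\<chi> i. f i) * (\<Prod>i\<in>UNIV. h i (f i)) \<partial>(\<Pi>\<^sub>M i\<in>UNIV. lborel))
      \<le> (\<integral>\<^sup>+f. w (\<chi> i. f i) * (\<Prod>i\<in>UNIV. k i (norm (f i))) \<partial>(\<Pi>\<^sub>M i\<in>UNIV. lborel))"
    using le by (intro nn_integral_PiM_radial_mono w_radial) auto
  then show ?thesis
    by (simp add: nn_integral_lborel_vec)
qed

section \<open>The radial estimate\<close>

definition radial_measure :: "nat \<Rightarrow> real measure" where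
  "radial_measure n = density lborel (\<lambda>r. ennreal (r ^ (n - 1)) * indicator {0<..} r)"

lemma sets_radial_measure [simp, measurable_cong]: "sets (radial_measure n) = sets borel"
  by (simp add: radial_measure_def)

lemma sigma_finite_radial_measure: "sigma_finite_measure (radial_measure n)"
  unfolding radial_measure_def
  by (subst sigma_finite_measure.sigma_finite_iff_density_finite[OF sigma_finite_lborel])
     (auto simp: ennreal_mult_eq_top_iff indicator_def)

lemma nn_integral_radial_measure:
  assumes [measurable]: "g \<in> borel_measurable borel"
  shows "(\<integral>\<^sup>+r. g r \<partial>radial_measure n) = (\<integral>\<^sup>+r\<in>{0<..}. g r * ennreal (r ^ (n - 1)) \<partial>lborel)"
  unfolding radial_measure_def by (subst nn_integral_density) (auto simp: mult_ac)

lemma AE_radial_measure: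
  assumes "AE r in radial_measure n. P r"
  shows "AE r in lborel. 0 < r \<longrightarrow> P r"
  using assms unfolding radial_measure_def
  by (subst (asm) AE_density) (auto elim!: eventually_mono simp: ennreal_zero_less_mult_iff)

text \<open>Substitution of \<open>c * r\<close> for \<open>r\<close>. With
  \<open>c = norm (y $ i)\<close> and the exponent \<open>1 / ps i\<close> this is the source of the
  powers of \<open>norm (y $ i)\<close> in the constant.\<close>

lemma nn_integral_radial_measure_scale:
  fixes g :: "real \<Rightarrow> ennreal"
  assumes g [measurable]: "g \<in> borel_measurable borel" and c: "0 < c" and n: "0 < n"
  shows "(\<integral>\<^sup>+r. g (r * c) \<partial>radial_measure n) = ennreal (c powr - real n) * (\<integral>\<^sup>+r. g r \<partial>radial_measure n)"
proof -
  have "(\<integral>\<^sup>+r. g r \<partial>radial_measure n)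
      = ennreal c * (\<integral>\<^sup>+r. g (c * r) * ennreal ((c * r) ^ (n - 1)) * indicator {0<..} (c * r) \<partial>lborel)"
    using c by (subst nn_integral_radial_measure[OF g], subst nn_integral_real_affine[of _ c 0]) auto
  also have "\<dots> = ennreal c * (\<integral>\<^sup>+r. ennreal (c ^ (n - 1)) * (g (r * c) * ennreal (r ^ (n - 1)) * indicator {0<..} r) \<partial>lborel)"
  proof (rule arg_cong[where f="\<lambda>x. ennreal c * x"], rule nn_integral_cong)
    fix r :: real
    show "g (c * r) * ennreal ((c * r) ^ (n - 1)) * indicator {0<..} (c * r)
        = ennreal (c ^ (n - 1)) * (g (r * c) * ennreal (r ^ (n - 1)) * indicator {0<..} r)"
      using c by (cases "0 < r") (auto simp: zero_less_mult_iff power_mult_distrib ennreal_mult mult_ac)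
  qed
  also have "\<dots> = ennreal (c ^ n) * (\<integral>\<^sup>+r. g (r * c) \<partial>radial_measure n)"
    using c n by (subst nn_integral_cmult, simp, subst nn_integral_radial_measure, simp)
      (simp add: mult.assoc[symmetric] ennreal_mult[symmetric] power_Suc[symmetric] del: power_Suc)
  finally have "ennreal (c powr - real n) * (\<integral>\<^sup>+r. g r \<partial>radial_measure n)
      = ennreal (c powr - real n * c ^ n) * (\<integral>\<^sup>+r. g (r * c) \<partial>radial_measure n)"
    using c by (simp add: ennreal_mult mult.assoc)
  also have "c powr - real n * c ^ n = 1"
    using c by (simp add: powr_minus powr_realpow)
  finally show ?thesis by simp
qed

section \<open>Angular norms and the estimate for nonnegative Borel functions\<close>

definition sphere_norm :: "real \<Rightarrow> ('a::euclidean_space \<Rightarrow> ennreal) \<Rightarrow> real \<Rightarrow> ennreal" where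
  "sphere_norm q h r = ennreal_powr (\<integral>\<^sup>+\<theta>. ennreal_powr (h (r *\<^sub>R \<theta>)) q \<partial>sphere_measure) (1 / q)"

lemma borel_measurable_sphere_norm [measurable]:
  assumes [measurable]: "h \<in> borel_measurable borel"
  shows "sphere_norm q h \<in> borel_measurable borel"
  unfolding sphere_norm_def[abs_def]
  using borel_measurable_sphere_integral[of "\<lambda>x. ennreal_powr (h x) q"] by measurable

abbreviation sphere_area :: "'a::euclidean_space itself \<Rightarrow> ennreal" where
  "sphere_area _ \<equiv> emeasure (sphere_measure :: 'a measure) (sphere 0 1)"

lemma sphere_area_cases:
  obtains s where "0 < s" "sphere_area TYPE('a::euclidean_space) = ennreal s"
  using emeasure_sphere_measure_sphere_neq_0[where 'a='a]
    finite_measure.emeasure_finite[OF finite_measure_sphere_measure[where 'a='a], of "sphere 0 1"]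
  by (cases "sphere_area TYPE('a)") (auto simp: less_le)

text \<open>Hoelder's inequality against the constant 1 gives the area to the power
  \<open>1 - 1 / q\<close>. One full factor of the area is the integral of 1, which leaves the
  exponent \<open>- (1 / q)\<close> and the form required for
  \<open>nn_integral_vec_radial_mono\<close>.\<close>

lemma nn_integral_sphere_le_sphere_norm:
  fixes h :: "'a::euclidean_space \<Rightarrow> ennreal"
  assumes h [measurable]: "h \<in> borel_measurable borel" and q: "1 \<le> q"
  shows "(\<integral>\<^sup>+\<theta>. h (r *\<^sub>R \<theta>) \<partial>sphere_measure)
    \<le> (\<integral>\<^sup>+\<theta>. ennreal_powr (sphere_area TYPE('a)) (- (1 / q)) * sphere_norm q h r \<partial>(sphere_measure :: 'a measure))"
proof -
  let ?s = "sphere_area TYPE('a)"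
  have meas [measurable]: "(\<lambda>\<theta>. h (r *\<^sub>R \<theta>)) \<in> borel_measurable sphere_measure"
    by (rule measurable_polar[OF h]) auto
  have "(\<integral>\<^sup>+\<theta>. h (r *\<^sub>R \<theta>) \<partial>sphere_measure) \<le> ennreal_powr ?s (1 - 1 / q) * sphere_norm q h r"
  proof (cases "q = 1")
    case True
    have "?s \<noteq> 0" "?s \<noteq> top"
      by (rule sphere_area_cases[where 'a='a]; simp)+
    then show ?thesis using True by (cases ?s) (auto simp: sphere_norm_def ennreal_eq_0_iff)
  next
    case False
    then have "(\<integral>\<^sup>+\<theta>. ennreal_powr (ennreal_powr (h (r *\<^sub>R \<theta>)) q) (1 / q) * ennreal_powr 1 (1 - 1 / q) \<partial>sphere_measure)
      \<le> ennreal_powr (\<integral>\<^sup>+\<theta>. ennreal_powr (h (r *\<^sub>R \<theta>)) q \<partial>sphere_measure) (1 / q)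
        * ennreal_powr (\<integral>\<^sup>+\<theta>. 1 \<partial>(sphere_measure :: 'a measure)) (1 - 1 / q)"
      using q by (intro nn_integral_Holder2) auto
    then show ?thesis
      using q by (simp add: ennreal_powr_powr sphere_norm_def mult.commute)
  qed
  also have "ennreal_powr ?s (1 - 1 / q) = ennreal_powr ?s (- (1 / q)) * ?s"
    using ennreal_powr_add[of ?s "- (1 / q)" 1] by simp
  finally show ?thesis
    by (simp add: mult_ac)
qed

text \<open>The factor \<open>ennreal_powr (sphere_area TYPE('a)) (1 / q)\<close> is the angular
  norm of the constant 1, so the left side is the \<open>p\<close>-th power of the mixed norm of
  \<open>F (norm x)\<close>.\<close>

lemma hausdorff_radial_Minkowski:
  fixes h :: "'m::finite \<Rightarrow> 'a::euclidean_space \<Rightarrow> ennreal" and w :: "'a^'m \<Rightarrow> ennreal"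
    and p q :: real and ps qs :: "'m \<Rightarrow> real"
  assumes w [measurable]: "w \<in> borel_measurable borel"
    and w_radial: "\<And>x y. (\<And>i. norm (x $ i) = norm (y $ i)) \<Longrightarrow> w x = w y"
    and h [measurable]: "\<And>i. h i \<in> borel_measurable borel"
    and p: "1 \<le> p" "\<And>i. 0 < ps i" "1 / p = (\<Sum>i\<in>UNIV. 1 / ps i)"
    and q: "1 \<le> q" "\<And>i. 0 < qs i" "1 / q = (\<Sum>i\<in>UNIV. 1 / qs i)"
  defines "F \<equiv> \<lambda>r. \<integral>\<^sup>+y. w y * (\<Prod>i\<in>UNIV. h i (r *\<^sub>R y $ i)) \<partial>lborel"
    and "C \<equiv> \<integral>\<^sup>+y. w y * (\<Prod>i\<in>UNIV. ennreal (norm (y $ i) powr - (real DIM('a) / ps i))) \<partial>lborel"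
    and "N \<equiv> \<lambda>i. ennreal_powr (\<integral>\<^sup>+r. ennreal_powr (sphere_norm (qs i) (h i) r) (ps i) \<partial>radial_measure DIM('a)) (1 / ps i)"
  shows "(\<integral>\<^sup>+r. ennreal_powr (ennreal_powr (sphere_area TYPE('a)) (1 / q) * F r) p \<partial>radial_measure DIM('a))
    \<le> ennreal_powr (C * (\<Prod>i\<in>UNIV. N i)) p"
proof -
  define s where "s = sphere_area TYPE('a)"
  define G where "G i = sphere_norm (qs i) (h i)" for i
  have G [measurable]: "G i \<in> borel_measurable borel" for i
    unfolding G_def by measurable
  have qs: "1 \<le> qs i" for i
  proof -
    have "1 / qs i \<le> (\<Sum>i\<in>UNIV. 1 / qs i)"
      using q(2) by (intro member_le_sum) (auto simp: less_imp_le)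
    also have "\<dots> \<le> 1" using q by (simp flip: q(3))
    finally show ?thesis using q(2)[of i] by (simp add: field_simps)
  qed
  \<comment> \<open>\<open>K\<close> is the integrand after averaging. For fixed \<open>y\<close>,
    \<open>B y\<close> will bound its norm in \<open>r\<close> with respect to
    \<open>radial_measure\<close>.\<close>
  define K where "K r y = w y * (\<Prod>i\<in>UNIV. G i (r * norm (y $ i)))" for r y
  have K [measurable]: "case_prod K \<in> borel_measurable (radial_measure DIM('a) \<Otimes>\<^sub>M lborel)"
    unfolding K_def[abs_def] by measurable
  have K_meas [measurable]: "K r \<in> borel_measurable borel" for r
    unfolding K_def[abs_def] by measurable
  define B where "B y = w y * (\<Prod>i\<in>UNIV. ennreal (norm (y $ i) powr - (real DIM('a) / ps i))) * (\<Prod>i\<in>UNIV. N i)" for y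
  have B [measurable]: "B \<in> borel_measurable lborel"
    unfolding B_def[abs_def] by measurable
  have average: "ennreal_powr s (1 / q) * F r \<le> (\<integral>\<^sup>+y. K r y \<partial>lborel)" if r: "0 < r" for r
  proof -
    define k where "k i t = ennreal_powr s (- (1 / qs i)) * G i (r * t)" for i t
    have [measurable]: "k i \<in> borel_measurable borel" for i
      unfolding k_def[abs_def] by measurable
    have "F r \<le> (\<integral>\<^sup>+y. w y * (\<Prod>i\<in>UNIV. k i (norm (y $ i))) \<partial>lborel)"
      unfolding F_def
    proof (rule nn_integral_vec_radial_mono[where h="\<lambda>i x. h i (r *\<^sub>R x)"])
      show "w x = w y" if "\<And>i. norm (x $ i) = norm (y $ i)" for x y
        using that by (rule w_radial)
      show "(\<integral>\<^sup>+\<theta>. h i (r *\<^sub>R t *\<^sub>R \<theta>) \<partial>sphere_measure) \<le> (\<integral>\<^sup>+\<theta>. k i t \<partial>(sphere_measure :: 'a measure))" for i t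
        using nn_integral_sphere_le_sphere_norm[OF h qs, of i "r * t" i] by (simp add: k_def G_def s_def)
    qed measurable
    also have "\<dots> = (\<Prod>i\<in>UNIV. ennreal_powr s (- (1 / qs i))) * (\<integral>\<^sup>+y. K r y \<partial>lborel)"
      by (subst nn_integral_cmult[symmetric]) (auto simp: K_def k_def prod.distrib mult_ac)
    \<comment> \<open>The exponents add up to \<open>- (1 / q)\<close>; multiplication by
      \<open>ennreal_powr s (1 / q)\<close> then cancels the area, which is neither 0 nor
      \<open>top\<close>.\<close>
    also have "(\<Prod>i\<in>UNIV. ennreal_powr s (- (1 / qs i))) = ennreal_powr s (- (1 / q))"
      by (simp add: ennreal_powr_sum[symmetric] q(3) sum_negf)
    finally have "ennreal_powr s (1 / q) * F r
        \<le> ennreal_powr s (1 / q) * (ennreal_powr s (- (1 / q)) * (\<integral>\<^sup>+y. K r y \<partial>lborel))"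
      by (rule mult_left_mono) simp
    also have "\<dots> = ennreal_powr s (1 / q + - (1 / q)) * (\<integral>\<^sup>+y. K r y \<partial>lborel)"
      by (simp only: ennreal_powr_add mult.assoc)
    also have "ennreal_powr s (1 / q + - (1 / q)) = 1"
      unfolding s_def by (rule sphere_area_cases[where 'a='a]) simp
    finally show ?thesis by simp
  qed
  have bound: "AE y in lborel. (\<integral>\<^sup>+r. ennreal_powr (K r y) p \<partial>radial_measure DIM('a)) \<le> ennreal_powr (B y) p"
  proof -
    \<comment> \<open>The dilation by \<open>norm (y $ i)\<close> requires a positive factor. At a
      zero component \<open>0 powr a = 0\<close> would make \<open>B y\<close> vanish, and the bound
      could fail.\<close>
    have "AE y in (lborel :: ('a^'m) measure). \<forall>i\<in>UNIV. y $ i \<noteq> 0"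
      by (rule AE_finite_allI) (auto intro: AE_vec_nth AE_lborel_neq)
    then show ?thesis
    proof eventually_elim
      \<comment> \<open>The numbers \<open>p / ps i\<close> are positive with sum 1 and serve as the
        exponents in Hoelder's inequality.\<close>
      case (elim y)
      have a: "0 < p / ps i" "(\<Sum>i\<in>UNIV. p / ps i) = 1" for i
        using p(1,2) sum_distrib_left[of p "\<lambda>i. 1 / ps i" UNIV] by (auto simp flip: p(3))
      have pow: "ennreal_powr (ennreal_powr x (ps i)) (p / ps i) = ennreal_powr x p" for x i
        using p(2)[of i] by (simp add: ennreal_powr_powr)
      have "(\<integral>\<^sup>+r. ennreal_powr (K r y) p \<partial>radial_measure DIM('a))
          = ennreal_powr (w y) p * (\<integral>\<^sup>+r. (\<Prod>i\<in>UNIV. ennreal_powr (ennreal_powr (G i (r * norm (y $ i))) (ps i)) (p / ps i)) \<partial>radial_measure DIM('a))"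
        by (subst nn_integral_cmult[symmetric]) (auto simp: K_def ennreal_powr_mult ennreal_powr_prod pow)
      also have "\<dots> \<le> ennreal_powr (w y) p * (\<Prod>i\<in>UNIV. ennreal_powr (\<integral>\<^sup>+r. ennreal_powr (G i (r * norm (y $ i))) (ps i) \<partial>radial_measure DIM('a)) (p / ps i))"
        using a by (intro mult_left_mono nn_integral_Holder) auto
      also have "\<dots> = ennreal_powr (w y) p * (\<Prod>i\<in>UNIV. ennreal_powr (ennreal (norm (y $ i) powr - (real DIM('a) / ps i)) * N i) p)"
      proof (intro arg_cong2[where f="(*)"] refl prod.cong)
        fix i
        have "(\<integral>\<^sup>+r. ennreal_powr (G i (r * norm (y $ i))) (ps i) \<partial>radial_measure DIM('a))
            = ennreal (norm (y $ i) powr - real DIM('a)) * (\<integral>\<^sup>+r. ennreal_powr (G i r) (ps i) \<partial>radial_measure DIM('a))"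
          using elim by (intro nn_integral_radial_measure_scale[where g="\<lambda>r. ennreal_powr (G i r) (ps i)"]) auto
        also have "\<dots> = ennreal_powr (ennreal (norm (y $ i) powr - (real DIM('a) / ps i)) * N i) (ps i)"
          using p(2)[of i] by (simp add: ennreal_powr_mult N_def G_def ennreal_powr_powr powr_powr)
        finally show "ennreal_powr (\<integral>\<^sup>+r. ennreal_powr (G i (r * norm (y $ i))) (ps i) \<partial>radial_measure DIM('a)) (p / ps i)
            = ennreal_powr (ennreal (norm (y $ i) powr - (real DIM('a) / ps i)) * N i) p"
          by (simp only: pow)
      qed
      also have "\<dots> = ennreal_powr (B y) p"
        by (simp only: B_def ennreal_powr_mult ennreal_powr_prod prod.distrib mult.assoc)
      finally show ?case .
    qed
  qed
  have "(\<integral>\<^sup>+r. ennreal_powr (ennreal_powr s (1 / q) * F r) p \<partial>radial_measure DIM('a))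
      \<le> (\<integral>\<^sup>+r. ennreal_powr (\<integral>\<^sup>+y. K r y \<partial>lborel) p \<partial>radial_measure DIM('a))"
  proof (rule nn_integral_mono_AE)
    have "AE r in radial_measure DIM('a). 0 < r"
      unfolding radial_measure_def by (subst AE_density) (auto simp: indicator_def)
    then show "AE r in radial_measure DIM('a). ennreal_powr (ennreal_powr s (1 / q) * F r) p
        \<le> ennreal_powr (\<integral>\<^sup>+y. K r y \<partial>lborel) p"
      by eventually_elim (use average p in \<open>auto intro!: ennreal_powr_mono\<close>)
  qed
  also have "\<dots> \<le> ennreal_powr (\<integral>\<^sup>+y. B y \<partial>lborel) p"
    by (rule nn_integral_Minkowski[OF sigma_finite_radial_measure sigma_finite_lborel p(1) K B bound])
  \<comment> \<open>This covers an infinite \<open>C\<close> together with a vanishing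
    \<open>N i\<close> as well; both sides are then 0.\<close>
  also have "(\<integral>\<^sup>+y. B y \<partial>lborel) = C * (\<Prod>i\<in>UNIV. N i)"
    unfolding B_def C_def by (rule nn_integral_multc) measurable
  finally show ?thesis by (simp add: s_def)
qed

section \<open>Borel representatives\<close>

lemma completion_ex_borel_measurable_complex:
  fixes g :: "'a \<Rightarrow> complex"
  assumes [measurable]: "g \<in> borel_measurable (completion M)"
  obtains g' where "g' \<in> borel_measurable M" "AE x in M. g x = g' x"
proof -
  have "(\<lambda>x. Re (g x)) \<in> borel_measurable (completion M)" "(\<lambda>x. Im (g x)) \<in> borel_measurable (completion M)"
    by measurable
  from this[THEN completion_ex_borel_measurable_real]
  obtain a b where [measurable]: "a \<in> borel_measurable M" "b \<in> borel_measurable M"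
    and ae: "AE x in M. Re (g x) = a x" "AE x in M. Im (g x) = b x"
    by auto
  show thesis
  proof (rule that)
    show "(\<lambda>x. Complex (a x) (b x)) \<in> borel_measurable M"
      unfolding Complex_eq by measurable
    show "AE x in M. g x = Complex (a x) (b x)"
      using ae by eventually_elim (simp add: complex_eq_iff)
  qed
qed

text \<open>Changing a function on a null set keeps it measurable for the completed measure. This
  gives the measurability of the Hausdorff integrand in \<open>y\<close>.\<close>

lemma measurable_completion_AE:
  fixes f g :: "'a \<Rightarrow> 'b::topological_space"
  assumes g: "g \<in> borel_measurable M" and ae: "AE x in M. f x = g x"
  shows "f \<in> borel_measurable (completion M)"
proof (rule borel_measurableI)
  fix S :: "'b set" assume "open S"
  then have meas: "g -` S \<inter> space M \<in> sets (completion M)"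
    by (intro sets_completionI_sets measurable_sets[OF g]) auto
  have "AE x in completion M. x \<in> g -` S \<inter> space M \<longleftrightarrow> x \<in> f -` S \<inter> space M"
    by (rule AE_completion) (use ae in \<open>auto elim!: eventually_mono\<close>)
  from completion.in_sets_AE[OF this meas]
  show "f -` S \<inter> space (completion M) \<in> sets (completion M)"
    by simp
qed

lemma radial_value_norm:
  assumes "radial \<Phi>"
  shows "radial_value \<Phi> (norm x) = \<Phi> x"
  unfolding radial_value_def
  by (rule the_equality) (use assms in \<open>unfold radial_def, blast+\<close>)

text \<open>By Fubini, a Borel representative of \<open>\<Phi>\<close> agrees with \<open>\<Phi>\<close> along almost every ray; its restriction to one
  such ray is a Borel representative of the profile.\<close>

lemma radial_value_AE_eq_borel:
  fixes \<Phi> :: "'a::euclidean_space \<Rightarrow> complex"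
  assumes "\<Phi> \<in> borel_measurable lebesgue" and "radial \<Phi>"
  obtains \<phi> where "\<phi> \<in> borel_measurable borel" "AE r in lborel. 0 < r \<longrightarrow> radial_value \<Phi> r = \<phi> r"
proof -
  obtain \<Psi> where \<Psi>: "\<Psi> \<in> borel_measurable lborel" "AE x in lborel. \<Phi> x = \<Psi> x"
    using completion_ex_borel_measurable_complex[OF assms(1)] by blast
  obtain \<theta> :: 'a where \<theta>: "norm \<theta> = 1" "AE r in lborel. 0 < r \<longrightarrow> \<Phi> (r *\<^sub>R \<theta>) = \<Psi> (r *\<^sub>R \<theta>)"
    using AE_ray[OF \<Psi>(2)] by blast
  show thesis
  proof (rule that)
    have "(\<lambda>r. r *\<^sub>R \<theta>) \<in> borel_measurable borel"
      by measurable
    then show "(\<lambda>r. \<Psi> (r *\<^sub>R \<theta>)) \<in> borel_measurable borel"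
      using measurable_compose \<Psi>(1) by (metis measurable_lborel1)
    show "AE r in lborel. 0 < r \<longrightarrow> radial_value \<Phi> r = \<Psi> (r *\<^sub>R \<theta>)"
      using \<theta>(2)
    proof eventually_elim
      case (elim r)
      then show ?case
        using radial_value_norm[OF assms(2), of "r *\<^sub>R \<theta>"] \<theta>(1) by auto
    qed
  qed
qed

section \<open>The mixed norm of representatives and of radially dominated functions\<close>

lemma rad_ang_norm_cong_AE:
  fixes f g :: "'a::euclidean_space \<Rightarrow> complex"
  assumes "AE x in lborel. f x = g x"
  shows "rad_ang_norm p q f = rad_ang_norm p q g"
  unfolding rad_ang_norm_def
proof (rule arg_cong[where f="\<lambda>x. ennreal_powr x (1 / p)"], rule nn_integral_cong_AE)
  show "AE r in lborel.
      ennreal_powr (\<integral>\<^sup>+ \<theta>. ennreal (norm (f (r *\<^sub>R \<theta>)) powr q) \<partial>sphere_measure) (p / q) * ennreal (r ^ (DIM('a) - 1)) * indicator {0<..} r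
    = ennreal_powr (\<integral>\<^sup>+ \<theta>. ennreal (norm (g (r *\<^sub>R \<theta>)) powr q) \<partial>sphere_measure) (p / q) * ennreal (r ^ (DIM('a) - 1)) * indicator {0<..} r"
    using AE_polar[OF assms]
  proof eventually_elim
    case (elim r)
    show ?case
    proof (cases "0 < r")
      case True
      then have "AE \<theta> in sphere_measure. f (r *\<^sub>R \<theta>) = g (r *\<^sub>R \<theta>)"
        using elim by simp
      then have "(\<integral>\<^sup>+ \<theta>. ennreal (norm (f (r *\<^sub>R \<theta>)) powr q) \<partial>sphere_measure)
          = (\<integral>\<^sup>+ \<theta>. ennreal (norm (g (r *\<^sub>R \<theta>)) powr q) \<partial>sphere_measure)"
        by (intro nn_integral_cong_AE) (auto elim!: eventually_mono)
      then show ?thesis by simp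
    qed simp
  qed
qed

lemma rad_ang_norm_borel:
  fixes g :: "'a::euclidean_space \<Rightarrow> complex"
  assumes [measurable]: "g \<in> borel_measurable borel" and "q \<noteq> 0"
  shows "rad_ang_norm p q g = ennreal_powr
    (\<integral>\<^sup>+r. ennreal_powr (sphere_norm q (\<lambda>x. ennreal (norm (g x))) r) p \<partial>radial_measure DIM('a)) (1 / p)"
proof -
  have meas: "(\<lambda>r. ennreal_powr (sphere_norm q (\<lambda>x. ennreal (norm (g x))) r) p) \<in> borel_measurable borel"
    by measurable
  show ?thesis
    unfolding rad_ang_norm_def nn_integral_radial_measure[OF meas]
    using assms(2) by (simp add: sphere_norm_def ennreal_powr_powr)
qed

text \<open>Used for \<open>hausdorff_op \<Phi> f\<close>. Only monotonicity of the integral is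
  applied to \<open>g\<close>; measurability enters through the dominating function
  \<open>F\<close>. The origin plays no part because the norm looks at \<open>r > 0\<close>
  only.\<close>

lemma rad_ang_norm_le_radial:
  fixes g :: "'a::euclidean_space \<Rightarrow> complex"
  assumes [measurable]: "F \<in> borel_measurable borel" and p: "0 < p" and q: "0 < q"
    and le: "\<And>x. x \<noteq> 0 \<Longrightarrow> ennreal (norm (g x)) \<le> F (norm x)"
  shows "rad_ang_norm p q g \<le> ennreal_powr
    (\<integral>\<^sup>+r. ennreal_powr (ennreal_powr (sphere_area TYPE('a)) (1 / q) * F r) p \<partial>radial_measure DIM('a)) (1 / p)"
  unfolding rad_ang_norm_def
proof (rule ennreal_powr_mono, subst nn_integral_radial_measure, measurable, rule nn_integral_mono)
  fix r :: real
  show "ennreal_powr (\<integral>\<^sup>+ \<theta>. ennreal (norm (g (r *\<^sub>R \<theta>)) powr q) \<partial>sphere_measure) (p / q)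
      * ennreal (r ^ (DIM('a) - 1)) * indicator {0<..} r
    \<le> ennreal_powr (ennreal_powr (sphere_area TYPE('a)) (1 / q) * F r) p * ennreal (r ^ (DIM('a) - 1)) * indicator {0<..} r"
  proof (cases "0 < r")
    case True
    have "(\<integral>\<^sup>+ \<theta>. ennreal (norm (g (r *\<^sub>R \<theta>)) powr q) \<partial>sphere_measure)
        \<le> (\<integral>\<^sup>+ \<theta>. ennreal_powr (F r) q \<partial>(sphere_measure :: 'a measure))"
    proof (rule nn_integral_mono)
      fix \<theta> :: 'a assume "\<theta> \<in> space sphere_measure"
      then have "norm \<theta> = 1" "\<theta> \<noteq> 0" by auto
      then have "ennreal (norm (g (r *\<^sub>R \<theta>))) \<le> F r"
        using le[of "r *\<^sub>R \<theta>"] True by simp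
      then have "ennreal_powr (ennreal (norm (g (r *\<^sub>R \<theta>)))) q \<le> ennreal_powr (F r) q"
        using q by (intro ennreal_powr_mono) auto
      then show "ennreal (norm (g (r *\<^sub>R \<theta>)) powr q) \<le> ennreal_powr (F r) q" by simp
    qed
    then have "ennreal_powr (\<integral>\<^sup>+ \<theta>. ennreal (norm (g (r *\<^sub>R \<theta>)) powr q) \<partial>sphere_measure) (p / q)
        \<le> ennreal_powr (ennreal_powr (F r) q * sphere_area TYPE('a)) (p / q)"
      using p q by (intro ennreal_powr_mono) auto
    also have "\<dots> = ennreal_powr (ennreal_powr (sphere_area TYPE('a)) (1 / q) * F r) p"
      using q by (simp add: ennreal_powr_mult ennreal_powr_powr mult.commute)
    finally show ?thesis
      by (intro mult_right_mono) auto
  qed simp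
qed (use p in simp)

section \<open>The Hausdorff integrand and its constant in terms of representatives\<close>

lemma AE_radial_value_quotient:
  fixes \<phi> :: "real \<Rightarrow> complex"
  assumes "AE r in lborel. 0 < r \<longrightarrow> radial_value \<Phi> r = \<phi> r" and "0 < c"
  shows "AE y in (lborel :: 'b::euclidean_space measure). radial_value \<Phi> (c / norm y) = \<phi> (c / norm y)"
  using AE_norm[OF AE_inverse[OF assms], where 'a='b] AE_lborel_neq[of 0]
  by eventually_elim auto

lemma hausdorff_const_eq:
  fixes \<Phi> :: "real^'n \<Rightarrow> complex" and ps :: "'m::finite \<Rightarrow> real"
  assumes \<phi>: "AE r in lborel. 0 < r \<longrightarrow> radial_value \<Phi> r = \<phi> r"
  shows "hausdorff_const \<Phi> ps = (\<integral>\<^sup>+y. ennreal (norm (\<phi> (1 / norm y)) / norm y ^ (CARD('n) * CARD('m)))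
      * (\<Prod>i\<in>UNIV. ennreal (norm (y $ i) powr - (real DIM(real^'n) / ps i))) \<partial>(lborel :: ((real^'n)^'m) measure))"
  unfolding hausdorff_const_def nn_integral_completion
proof (rule nn_integral_cong_AE)
  show "AE y in (lborel :: ((real^'n)^'m) measure). ennreal (norm (radial_value \<Phi> (1 / norm y))
        / (norm y ^ (CARD('n) * CARD('m)) * (\<Prod>i\<in>UNIV. norm (y $ i) powr (real CARD('n) / ps i))))
      = ennreal (norm (\<phi> (1 / norm y)) / norm y ^ (CARD('n) * CARD('m)))
      * (\<Prod>i\<in>UNIV. ennreal (norm (y $ i) powr - (real DIM(real^'n) / ps i)))"
    using AE_radial_value_quotient[OF \<phi> zero_less_one]
  proof eventually_elim
    case (elim y)
    \<comment> \<open>This holds for zero components too: \<open>0 powr a = 0\<close> and division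
      by 0 gives 0 on both sides.\<close>
    have "(\<Prod>i\<in>UNIV. norm (y $ i) powr - (real DIM(real^'n) / ps i))
        = 1 / (\<Prod>i\<in>UNIV. norm (y $ i) powr (real CARD('n) / ps i))"
      by (simp add: powr_minus_divide prod_dividef)
    then have "(\<Prod>i\<in>UNIV. ennreal (norm (y $ i) powr - (real DIM(real^'n) / ps i)))
        = ennreal (1 / (\<Prod>i\<in>UNIV. norm (y $ i) powr (real CARD('n) / ps i)))"
      by (simp only: prod_ennreal powr_ge_zero)
    then show ?case
      unfolding elim by (simp only: ennreal_mult[symmetric] zero_le_divide_iff norm_ge_zero zero_le_power prod_nonneg
          powr_ge_zero divide_divide_eq_left times_divide_eq_right mult_1_right zero_le_one simp_thms)
  qed
qed

text \<open>Here \<open>x\<close> is any fixed nonzero point. As \<Phi> is radial, only its profile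
  at \<open>norm x / norm y\<close> matters, and the bad arguments of the profile come from a null
  set of \<open>y\<close>.\<close>

lemma AE_hausdorff_integrand_eq:
  fixes \<Phi> :: "real^'n \<Rightarrow> complex" and f g :: "'m::finite \<Rightarrow> real^'n \<Rightarrow> complex"
  assumes \<Phi>: "radial \<Phi>" and \<phi>: "AE r in lborel. 0 < r \<longrightarrow> radial_value \<Phi> r = \<phi> r"
    and fg: "\<And>i. AE x in lborel. f i x = g i x" and x: "x \<noteq> 0"
  shows "AE y in lborel. hausdorff_integrand \<Phi> f x y
    = \<phi> (norm x / norm y) / complex_of_real (norm y ^ (CARD('n) * CARD('m))) * (\<Prod>i\<in>UNIV. g i (y $ i))"
proof -
  have "AE y in (lborel :: ((real^'n)^'m) measure). \<forall>i\<in>UNIV. f i (y $ i) = g i (y $ i)"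
    by (rule AE_finite_allI) (auto intro: AE_vec_nth fg)
  moreover have "AE y in (lborel :: ((real^'n)^'m) measure). radial_value \<Phi> (norm x / norm y) = \<phi> (norm x / norm y)"
    using x by (intro AE_radial_value_quotient[OF \<phi>]) simp
  ultimately show ?thesis
  proof eventually_elim
    case (elim y)
    have "\<Phi> (x /\<^sub>R norm y) = radial_value \<Phi> (norm x / norm y)"
      using radial_value_norm[OF \<Phi>, of "x /\<^sub>R norm y"] by (simp add: divide_inverse mult.commute)
    then show ?case
      using elim by (simp add: hausdorff_integrand_def)
  qed
qed

text \<open>Replacing \<open>y\<close> by \<open>r *\<^sub>R y\<close> moves \<open>r\<close> from
  the kernel into the functions \<open>g i\<close>; the Jacobian cancels the power of
  \<open>r\<close> in the denominator.\<close>

lemma nn_integral_hausdorff_integrand: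
  fixes g :: "'m::finite \<Rightarrow> real^'n \<Rightarrow> complex"
  assumes [measurable]: "\<phi> \<in> borel_measurable borel" "\<And>i. g i \<in> borel_measurable borel" and r: "0 < r"
  shows "(\<integral>\<^sup>+y. ennreal (norm (\<phi> (r / norm y) / complex_of_real (norm y ^ (CARD('n) * CARD('m))) * (\<Prod>i\<in>UNIV. g i (y $ i)))) \<partial>lborel)
    = (\<integral>\<^sup>+y. ennreal (norm (\<phi> (1 / norm y)) / norm y ^ (CARD('n) * CARD('m))) * (\<Prod>i\<in>UNIV. ennreal (norm (g i (r *\<^sub>R y $ i)))) \<partial>lborel)"
    (is "(\<integral>\<^sup>+y. ?h y \<partial>lborel) = ?R")
proof -
  let ?d = "CARD('n) * CARD('m)"
  have dim: "DIM((real^'n)^'m) = ?d" by simp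
  have "(\<integral>\<^sup>+y. ?h y \<partial>lborel) = ennreal (r ^ ?d) * (\<integral>\<^sup>+y. ?h (r *\<^sub>R y) \<partial>lborel)"
    using nn_integral_lborel_scaleR[OF _ r, of ?h] unfolding dim by simp
  also have "\<dots> = (\<integral>\<^sup>+y. ennreal (r ^ ?d) * ?h (r *\<^sub>R y) \<partial>lborel)"
    by (rule nn_integral_cmult[symmetric]) measurable
  also have "\<dots> = ?R"
  proof (rule nn_integral_cong)
    fix y :: "(real^'n)^'m"
    have "r ^ ?d * norm (\<phi> (r / norm (r *\<^sub>R y)) / complex_of_real (norm (r *\<^sub>R y) ^ ?d) * (\<Prod>i\<in>UNIV. g i ((r *\<^sub>R y) $ i)))
       = norm (\<phi> (1 / norm y)) / norm y ^ ?d * (\<Prod>i\<in>UNIV. norm (g i (r *\<^sub>R y $ i)))"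
      using r by (simp add: norm_mult norm_divide norm_power power_mult_distrib prod_norm[symmetric])
    then show "ennreal (r ^ ?d) * ?h (r *\<^sub>R y)
       = ennreal (norm (\<phi> (1 / norm y)) / norm y ^ ?d) * (\<Prod>i\<in>UNIV. ennreal (norm (g i (r *\<^sub>R y $ i))))"
      using r by (simp add: prod_ennreal ennreal_mult[symmetric] prod_nonneg del: norm_scaleR vector_scaleR_component)
  qed
  finally show ?thesis .
qed

section \<open>The norm inequality and almost everywhere integrability\<close>

theorem theorem1p4:
  fixes \<Phi> :: "real^'n \<Rightarrow> complex"
    and p q :: real
    and ps qs :: "'m::finite \<Rightarrow> real"
    and f :: "'m \<Rightarrow> real^'n \<Rightarrow> complex"
  assumes "CARD('n) \<ge> 2"
    and "\<Phi> \<in> borel_measurable lebesgue" and "radial \<Phi>"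
    and "1 \<le> p" and "1 \<le> q"
    and "\<And>i. 0 < ps i" and "\<And>i. 0 < qs i"
    and "1 / p = (\<Sum>i\<in>UNIV. 1 / ps i)"
    and "1 / q = (\<Sum>i\<in>UNIV. 1 / qs i)"
    and "\<And>i. f i \<in> rad_ang_space (ps i) (qs i)"
  shows "(hausdorff_const \<Phi> ps < \<infinity> \<longrightarrow>
            (AE x in lebesgue. integrable lebesgue (hausdorff_integrand \<Phi> f x)))
    \<and> rad_ang_norm p q (hausdorff_op \<Phi> f)
        \<le> hausdorff_const \<Phi> ps * (\<Prod>i\<in>UNIV. rad_ang_norm (ps i) (qs i) (f i))"
proof -
  obtain \<phi> where \<phi> [measurable]: "\<phi> \<in> borel_measurable borel"
    and \<phi>_eq: "AE r in lborel. 0 < r \<longrightarrow> radial_value \<Phi> r = \<phi> r"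
    by (rule radial_value_AE_eq_borel[OF assms(2,3)])
  have "\<exists>g. g \<in> borel_measurable borel \<and> (AE x in lborel. f i x = g x)" for i
  proof -
    have "f i \<in> borel_measurable lebesgue"
      using assms(10)[of i] by (simp add: rad_ang_space_def)
    then show ?thesis
      by (rule completion_ex_borel_measurable_complex) auto
  qed
  then obtain g where g [measurable]: "\<And>i. g i \<in> borel_measurable borel"
    and fg: "\<And>i. AE x in lborel. f i x = g i x"
    by metis
  define w where "w y = ennreal (norm (\<phi> (1 / norm y)) / norm y ^ (CARD('n) * CARD('m)))" for y :: "(real^'n)^'m"
  have w [measurable]: "w \<in> borel_measurable borel"
    unfolding w_def[abs_def] by measurable
  \<comment> \<open>By \<open>norm_vec_def\<close> the norm of a vector depends only on the norms of
    its components.\<close>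
  have w_radial: "w x = w y" if "\<And>i. norm (x $ i) = norm (y $ i)" for x y
    using that by (simp add: w_def norm_vec_def)
  define h where "h i x = ennreal (norm (g i x))" for i x
  have h [measurable]: "h i \<in> borel_measurable borel" for i
    unfolding h_def[abs_def] by measurable
  define F where "F r = (\<integral>\<^sup>+y. w y * (\<Prod>i\<in>UNIV. h i (r *\<^sub>R y $ i)) \<partial>lborel)" for r
  have F [measurable]: "F \<in> borel_measurable borel"
    unfolding F_def[abs_def] by measurable
  define C where "C = hausdorff_const \<Phi> ps"
  define N where "N i = rad_ang_norm (ps i) (qs i) (f i)" for i
  have p: "0 < p" and q: "0 < q" using assms by auto
  have N_eq: "N i = ennreal_powr (\<integral>\<^sup>+r. ennreal_powr (sphere_norm (qs i) (h i) r) (ps i) \<partial>radial_measure DIM(real^'n)) (1 / ps i)" for i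
    using rad_ang_norm_borel[OF g, of "qs i" "ps i" i] assms(7)[of i] rad_ang_norm_cong_AE[OF fg, of "ps i" "qs i" i]
    by (simp add: N_def h_def[abs_def])
  have main: "(\<integral>\<^sup>+r. ennreal_powr (ennreal_powr (sphere_area TYPE(real^'n)) (1 / q) * F r) p \<partial>radial_measure DIM(real^'n))
      \<le> ennreal_powr (C * (\<Prod>i\<in>UNIV. N i)) p"
    unfolding F_def N_eq C_def hausdorff_const_eq[OF \<phi>_eq] w_def[symmetric]
    by (rule hausdorff_radial_Minkowski[OF w w_radial h assms(4,6,8,5,7,9)])
  \<comment> \<open>This identity yields both the pointwise bound on the operator and, once
    \<open>F (norm x)\<close> is known to be finite, the integrability.\<close>
  have int_eq: "(\<integral>\<^sup>+y. ennreal (norm (hausdorff_integrand \<Phi> f x y)) \<partial>lebesgue) = F (norm x)" if x: "x \<noteq> 0" for x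
  proof -
    have "(\<integral>\<^sup>+y. ennreal (norm (hausdorff_integrand \<Phi> f x y)) \<partial>lborel)
        = (\<integral>\<^sup>+y. ennreal (norm (\<phi> (norm x / norm y) / complex_of_real (norm y ^ (CARD('n) * CARD('m))) * (\<Prod>i\<in>UNIV. g i (y $ i)))) \<partial>lborel)"
      using AE_hausdorff_integrand_eq[where f=f and g=g, OF assms(3) \<phi>_eq fg x]
      by (intro nn_integral_cong_AE) (auto elim!: eventually_mono)
    also have "\<dots> = F (norm x)"
      using nn_integral_hausdorff_integrand[OF \<phi> g, of "norm x"] x by (simp add: F_def w_def h_def)
    finally show ?thesis by (simp add: nn_integral_completion)
  qed
  have "ennreal (norm (hausdorff_op \<Phi> f x)) \<le> F (norm x)" if x: "x \<noteq> 0" for x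
  \<comment> \<open>Without integrability the Bochner integral has the default value 0 and the bound
    is trivial.\<close>
  proof (cases "integrable lebesgue (hausdorff_integrand \<Phi> f x)")
    case True
    then show ?thesis
      using integral_norm_bound_ennreal[OF True] int_eq[OF x] by (simp add: hausdorff_op_def)
  qed (simp add: hausdorff_op_def not_integrable_integral_eq)
  then have "rad_ang_norm p q (hausdorff_op \<Phi> f) \<le> ennreal_powr
      (\<integral>\<^sup>+r. ennreal_powr (ennreal_powr (sphere_area TYPE(real^'n)) (1 / q) * F r) p \<partial>radial_measure DIM(real^'n)) (1 / p)"
    by (rule rad_ang_norm_le_radial[OF F p q])
  also have "\<dots> \<le> ennreal_powr (ennreal_powr (C * (\<Prod>i\<in>UNIV. N i)) p) (1 / p)"
    using main p by (intro ennreal_powr_mono) auto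
  also have "\<dots> = C * (\<Prod>i\<in>UNIV. N i)"
    using p by (simp add: ennreal_powr_powr)
  finally have norm_le: "rad_ang_norm p q (hausdorff_op \<Phi> f) \<le> C * (\<Prod>i\<in>UNIV. N i)" .
  have "AE x in lebesgue. integrable lebesgue (hausdorff_integrand \<Phi> f x)" if "C < \<infinity>"
  proof -
    have "N i < top" for i
      using assms(10)[of i] by (simp add: N_def rad_ang_space_def)
    then have "(\<Prod>i\<in>UNIV. N i) < top"
      by (simp add: ennreal_prod_eq_top less_top[symmetric])
    then have "C * (\<Prod>i\<in>UNIV. N i) < top"
      using that by (simp add: ennreal_mult_less_top)
    then have "(\<integral>\<^sup>+r. ennreal_powr (ennreal_powr (sphere_area TYPE(real^'n)) (1 / q) * F r) p \<partial>radial_measure DIM(real^'n)) \<noteq> \<infinity>"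
      using main by (metis ennreal_powr_less_top_iff infinity_ennreal_def less_le_trans not_less_iff_gr_or_eq order.strict_trans1)
    then have "AE r in radial_measure DIM(real^'n). ennreal_powr (ennreal_powr (sphere_area TYPE(real^'n)) (1 / q) * F r) p \<noteq> \<infinity>"
      by (intro nn_integral_PInf_AE) auto
    \<comment> \<open>Finiteness passes to \<open>F r\<close> because the area of the sphere is
      nonzero; an area 0 would hide an infinite \<open>F r\<close>.\<close>
    then have "AE r in radial_measure DIM(real^'n). F r < top"
      by eventually_elim
        (use emeasure_sphere_measure_sphere_neq_0[where 'a="real^'n"] in \<open>auto simp: ennreal_mult_eq_top_iff less_top[symmetric]\<close>)
    then have "AE x in lborel. x \<noteq> 0 \<longrightarrow> F (norm (x :: real^'n)) < top"
      by (intro AE_norm AE_radial_measure)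
    then have "AE x in lborel. integrable lebesgue (hausdorff_integrand \<Phi> f x)"
      using AE_lborel_neq[of 0]
    proof eventually_elim
      case (elim x)
      then have x: "x \<noteq> 0" by simp
      have "hausdorff_integrand \<Phi> f x \<in> borel_measurable lebesgue"
        by (rule measurable_completion_AE[OF _ AE_hausdorff_integrand_eq[where f=f and g=g, OF assms(3) \<phi>_eq fg x]]) measurable
      then show ?case
        using elim int_eq[OF x] by (simp add: integrable_iff_bounded)
    qed
    then show ?thesis by (rule AE_completion)
  qed
  then show ?thesis
    using norm_le by (simp add: C_def N_def)
qed

end
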